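(* Let $A:\mathbb T^n\to\mathbb R$ satisfy $0<\alpha_0\le A(\boldsymbol y)\le \alpha_1<\infty$ for all $\boldsymbol y\in\mathbb T^n$, and suppose that its Fourier coefficients satisfy $|\widehat A_{\boldsymbol k}|\le C_A(1+|\boldsymbol k|)^{-N}$ for all $\boldsymbol k\in\mathbb Z^n$, where $C_A>0$ is independent of $\boldsymbol k$. Let $m\ge 0$ be an integer and suppose $N>n+m+1$. Then for every $F\in\overline H_{P,0}^{-1}(\mathbb T^n)\cap\overline H_{P,0}^{m}(\mathbb T^n)$, the variational problem: find $U\in\overline H_{P,0}^1(\mathbb T^n)$ such that $$a(U,V)=\langle F,V\rangle\qquad\forall V\in\overline H_{P,0}^1(\mathbb T^n)$$ has a unique solution $U\in\overline H_{P,0}^{1}(\mathbb T^n)\cap\overline H_{P,0}^{m+2}(\mathbb T^n)$. Moreover, $$\|U\|_{\overline H_{P,0}^{m+2}}\le C_m\left(\|F\|_{\overline H_{P,0}^{-1}}+\|F\|_{\overline H_{P,0}^{m}}\right),$$ where $$C_m=\alpha_0^{-1}\sqrt{(m+1)!}\,\sqrt d\,M_m,\qquad M_0=\max\{\alpha_0^{-1}C_{\lambda,A,1},\,1\},$$ and, for $m\ge1$, $$M_m=\max\left\{\alpha_0^{-1}C_{\lambda,A,m+1}+2\sum_{j=1}^m\sqrt{\binom{j+d-1}{d-1}}\,C_{\lambda,A,m+1-j}C_{j-1},\ \ 1+\sum_{j=1}^m\sqrt{\binom{j+d-1}{d-1}}\,C_{\lambda,A,m+1-j}C_{j-1}\r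ight\}.$$
   Context: Let $d,n\ge1$ be integers and let $P\in\mathbb R^{d\times n}$ have columns that are linearly independent over $\mathbb Q$ (hence $P\boldsymbol k\ne0$ for $\boldsymbol k\in\mathbb Z^n\setminus\{\boldsymbol 0\}$). Let $\mathbb T^n=(\mathbb R/2\pi\mathbb Z)^n$. A formal Fourier series $U=\sum_{\boldsymbol k\in\mathbb Z^n}\widehat U_{\boldsymbol k}e^{\mathrm i\boldsymbol k^\top\boldsymbol y}$ is identified with its family of complex coefficients. For $s\in\mathbb R$, $\overline H_{P,0}^s(\mathbb T^n)$ is the Hilbert space of those $U$ with $\widehat U_{\boldsymbol 0}=0$ and $\|U\|_{\overline H_{P,0}^s}^2:=\sum_{\boldsymbol k\neq\boldsymbol 0}|P\boldsymbol k|^{2s}|\widehat U_{\boldsymbol k}|^2<\infty$. The bilinear (sesquilinear) form is $a(U,V)=(AP\nabla U,P\nabla V)$, where $P\nabla U=\sum_{\boldsymbol k\ne\boldsymbol 0}\mathrm i\,P\boldsymbol k\,\widehat U_{\boldsymbol k}e^{\mathrm i\boldsymbol k^\top\boldsymbol y}\in L^2(\mathbb T^n)^d$ and $(\cdot,\cdot)$ is the $L^2(\mathbb T^n)$ inner product normalized so that the $e^{\mathrm i\boldsymbol k^\top\boldsymbol y}$ are orthonormal; $\langle F,V\rangle=\sum_{\boldsymbol k\ne\boldsymbol 0}\widehat F_{\boldsymbol k}\overline{\widehat V_{\boldsymbol k}}$. Constants: $C_\lambda=\sqrt{\lambda_{\max}(P^\top P)}$, with $\lambda_{\max}$ the largest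 eigenvalue, and for an integer $0\le b<N-n$, $C_{\lambda,A,b}:=C_\lambda^{b}\,C_A\sum_{\boldsymbol k\in\mathbb Z^n}(1+|\boldsymbol k|)^{b-N}$. The constants $C_m$ and $M_m$ are defined recursively in $m$ by the formulas in the claim. *)

theory Defs
  imports "HOL-Analysis.Analysis"
begin

section \<open>Lattice frequencies and the projection matrix\<close>

definition real_vec :: "int ^ 'n \<Rightarrow> real ^ 'n" where
  "real_vec k = (\<chi> i. real_of_int (k $ i))"

text \<open>Linear independence over the rationals of the \<^emph>\<open>family\<close> of columns
  (so repeated columns are excluded).\<close>

definition rat_independent_columns :: "real ^ 'n ^ 'd \<Rightarrow> bool" where
  "rat_independent_columns P \<longleftrightarrow>
     (\<forall>q :: 'n \<Rightarrow> rat. (\<Sum>i\<in>UNIV. of_rat (q i) *\<^sub>R column i P) = 0 \<longrightarrow> (\<forall>i. q i = 0))"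

definition is_eigenvalue :: "real ^ 'n ^ 'n \<Rightarrow> real \<Rightarrow> bool" where
  "is_eigenvalue B l \<longleftrightarrow> (\<exists>v. v \<noteq> 0 \<and> B *v v = l *\<^sub>R v)"

definition lambda_max :: "real ^ 'n ^ 'n \<Rightarrow> real" where
  "lambda_max B = (GREATEST l. is_eigenvalue B l)"


section \<open>Functions on the torus\<close>

text \<open>A function on \<open>(\<real> / 2 \<pi> \<int>)\<^sup>n\<close> is a function on \<open>\<real>\<^sup>n\<close> that is \<open>2 \<pi>\<close>-periodic in
  every coordinate; integrals over the torus are taken over the closed fundamental cell and
  normalised to total mass 1, which makes the characters orthonormal.\<close>

definition torus_periodic :: "(real ^ 'n \<Rightarrow> 'a) \<Rightarrow> bool" where
  "torus_periodic f \<longleftrightarrow> (\<forall>y i. f (y + axis i (2 * pi)) = f y)"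

definition torus_cell :: "(real ^ 'n) set" where
  "torus_cell = cbox 0 (\<chi> i. 2 * pi)"

definition torus_mean :: "(real ^ 'n \<Rightarrow> 'a::{banach, second_countable_topology}) \<Rightarrow> 'a" where
  "torus_mean f = (LINT y|lebesgue_on torus_cell. f y) /\<^sub>R (2 * pi) ^ CARD('n)"

definition torus_char :: "int ^ 'n \<Rightarrow> real ^ 'n \<Rightarrow> complex" where
  "torus_char k y = exp (\<i> * complex_of_real (real_vec k \<bullet> y))"

definition fourier_coeff :: "(real ^ 'n \<Rightarrow> complex) \<Rightarrow> int ^ 'n \<Rightarrow> complex" where
  "fourier_coeff f k = torus_mean (\<lambda>y. f y * cnj (torus_char k y))"

definition torus_L2 :: "(real ^ 'n \<Rightarrow> complex ^ 'd) set" where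
  "torus_L2 = {g \<in> borel_measurable (lebesgue_on torus_cell).
                 integrable (lebesgue_on torus_cell) (\<lambda>y. (norm (g y))\<^sup>2)}"

definition L2_inner :: "(real ^ 'n \<Rightarrow> complex ^ 'd) \<Rightarrow> (real ^ 'n \<Rightarrow> complex ^ 'd) \<Rightarrow> complex" where
  "L2_inner g h = torus_mean (\<lambda>y. \<Sum>j\<in>UNIV. g y $ j * cnj (h y $ j))"

text \<open>The Fourier series with coefficients \<open>c\<close> converges unconditionally to \<open>g\<close> in the
  \<open>L\<^sup>2\<close> norm.\<close>

definition has_L2_fourier_series ::
    "(int ^ 'n \<Rightarrow> complex ^ 'd) \<Rightarrow> (real ^ 'n \<Rightarrow> complex ^ 'd) \<Rightarrow> bool" where
  "has_L2_fourier_series c g \<longleftrightarrow> g \<in> torus_L2 \<and>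
     ((\<lambda>S. torus_mean (\<lambda>y. (norm (g y - (\<Sum>k\<in>S. torus_char k y *s c k)))\<^sup>2)) \<longlongrightarrow> 0)
       (finite_subsets_at_top UNIV)"


section \<open>The spaces of formal Fourier series and the variational form\<close>

text \<open>A formal Fourier series is its family of coefficients. The exponent \<open>s\<close> is an arbitrary
  real number; for \<open>k \<noteq> 0\<close> the base \<open>norm (P *v real_vec k)\<close> is positive under
  rational independence of the columns, so \<open>powr\<close> is the usual real power.\<close>

definition HP_space :: "real ^ 'n ^ 'd \<Rightarrow> real \<Rightarrow> (int ^ 'n \<Rightarrow> complex) set" where
  "HP_space P s = {U. U 0 = 0 \<and>
     (\<lambda>k. norm (P *v real_vec k) powr (2 * s) * (norm (U k))\<^sup>2) summable_on (- {0})}"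

definition HP_norm :: "real ^ 'n ^ 'd \<Rightarrow> real \<Rightarrow> (int ^ 'n \<Rightarrow> complex) \<Rightarrow> real" where
  "HP_norm P s U = sqrt (\<Sum>\<^sub>\<infinity>k\<in>- {0}. norm (P *v real_vec k) powr (2 * s) * (norm (U k))\<^sup>2)"

text \<open>The \<open>L\<^sup>2\<close> function \<open>P\<nabla>U\<close>, chosen among its almost everywhere equal representatives;
  for \<open>U \<in> HP_space P 1\<close> one exists by the Riesz--Fischer theorem. The coefficient at
  \<open>k = 0\<close> vanishes because \<open>P *v 0 = 0\<close>.\<close>

definition P_grad :: "real ^ 'n ^ 'd \<Rightarrow> (int ^ 'n \<Rightarrow> complex) \<Rightarrow> real ^ 'n \<Rightarrow> complex ^ 'd" where
  "P_grad P U = (SOME G. has_L2_fourier_series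
     (\<lambda>k. \<chi> j. \<i> * complex_of_real ((P *v real_vec k) $ j) * U k) G)"

definition a_form :: "(real ^ 'n \<Rightarrow> real) \<Rightarrow> real ^ 'n ^ 'd \<Rightarrow>
    (int ^ 'n \<Rightarrow> complex) \<Rightarrow> (int ^ 'n \<Rightarrow> complex) \<Rightarrow> complex" where
  "a_form A P U V = L2_inner (\<lambda>y. complex_of_real (A y) *s P_grad P U y) (P_grad P V)"

definition HP_pairing :: "(int ^ 'n \<Rightarrow> complex) \<Rightarrow> (int ^ 'n \<Rightarrow> complex) \<Rightarrow> complex" where
  "HP_pairing F V = (\<Sum>\<^sub>\<infinity>k\<in>- {0}. F k * cnj (V k))"


section \<open>Constants\<close>

definition C_lambda :: "real ^ 'n ^ 'd \<Rightarrow> real" where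
  "C_lambda P = sqrt (lambda_max (transpose P ** P))"

definition C_lambda_A :: "real ^ 'n ^ 'd \<Rightarrow> real \<Rightarrow> real \<Rightarrow> nat \<Rightarrow> real" where
  "C_lambda_A P C_A N b = C_lambda P ^ b * C_A *
     (\<Sum>\<^sub>\<infinity>k\<in>(UNIV :: (int ^ 'n) set). (1 + norm (real_vec k)) powr (real b - N))"

text \<open>Simultaneous recursion for \<open>M\<^sub>m\<close> and \<open>C\<^sub>m\<close>; the argument \<open>B\<close> stands for
  \<open>b \<mapsto> C\<^bsub>\<lambda>,A,b\<^esub>\<close>.\<close>

function M_const :: "real \<Rightarrow> nat \<Rightarrow> (nat \<Rightarrow> real) \<Rightarrow> nat \<Rightarrow> real"
  and C_const :: "real \<Rightarrow> nat \<Rightarrow> (nat \<Rightarrow> real) \<Rightarrow> nat \<Rightarrow> real" where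
  "M_const \<alpha>0 d B m =
     (if m = 0 then max (inverse \<alpha>0 * B 1) 1
      else max
        (inverse \<alpha>0 * B (m + 1)
           + 2 * (\<Sum>j\<in>{1..m}. sqrt (real ((j + d - 1) choose (d - 1)))
                    * B (m + 1 - j) * C_const \<alpha>0 d B (j - 1)))
        (1 + (\<Sum>j\<in>{1..m}. sqrt (real ((j + d - 1) choose (d - 1)))
                    * B (m + 1 - j) * C_const \<alpha>0 d B (j - 1))))"
| "C_const \<alpha>0 d B m = inverse \<alpha>0 * sqrt (fact (m + 1)) * sqrt (real d) * M_const \<alpha>0 d B m"
  by pat_completeness auto
termination
  by (relation "Wellfounded.measure (case_sum (\<lambda>(_, _, _, m). 2 * m) (\<lambda>(_, _, _, m). 2 * m + 1))") auto

declare M_const.simps [simp del] C_const.simps [simp del]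

end

theory Submission
  imports Defs
begin

text \<open>Put \<open>p\<^sub>k = P k\<close> and \<open>u\<^sub>k = |p\<^sub>k| U\<^sub>k\<close>. By Parseval the variational form becomes the form
  \<open>\<langle>T u, v\<rangle>\<close> on \<open>\<ell>\<^sup>2\<close>, where \<open>T\<close> is the matrix \<open>h k l = A\<^sub>k\<^sub>-\<^sub>l (e\<^sub>k \<bullet> e\<^sub>l)\<close> with \<open>A\<^sub>q\<close> the Fourier
  coefficients of \<open>A\<close> and \<open>e\<^sub>k = p\<^sub>k / |p\<^sub>k|\<close>. It is dominated by the convolution with the summable
  sequence \<open>|A\<^sub>q|\<close>, hence bounded, and it is coercive because \<open>A \<ge> \<alpha>0\<close>; so \<open>T u = f\<close> with
  \<open>f\<^sub>k = F\<^sub>k / |p\<^sub>k|\<close> is uniquely solvable. Testing with \<open>|p|\<^bsup>2s\<^esup> u\<close> and estimating the commutator of \<open>T\<close>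
  with the weight \<open>|p|\<^sup>s\<close> through \<open>||p\<^sub>k| - |p\<^sub>l|| \<le> |p\<^sub>k\<^sub>-\<^sub>l|\<close> and the binomial theorem gives
  \<open>\<alpha>0 \<parallel>|p|\<^sup>s u\<parallel> \<le> \<parallel>|p|\<^sup>s f\<parallel> + (\<Sum>j<s. (s choose j) C\<^bsub>\<lambda>,A,s-j\<^esub> \<parallel>|p|\<^sup>j u\<parallel>)\<close>, and the constants follow by induction
  on \<open>s\<close>, interpolating \<open>\<parallel>|p|\<^sup>j f\<parallel>\<close> between \<open>\<parallel>f\<parallel>\<close> and \<open>\<parallel>|p|\<^sup>s f\<parallel>\<close>.\<close>


section \<open>Square summable families\<close>

text \<open>Rational independence makes every |p_k| with k \<noteq> 0 positive, but in general not
  bounded away from 0. The spaces are then not nested, neither norm of F controls the other, and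
  each interpolation must be an inequality r^j \<le> a + b r^s on all of r \<ge> 0. Passing to u
  absorbs one order: \<open>HP_space P 1\<close> becomes the square summable families vanishing at
  0, and F in orders -1 and m becomes f with weights r^0 and r^(m+1). Level s of the induction is
  order s + 1 of U, so \<open>C_const\<close> at m bounds order m + 2. The vector structure survives
  only in the factor e_k . e_l of modulus at most 1. The commutator estimate is therefore scalar and
  produces (s choose j) where \<open>M_const\<close> has the square root of (j+d-1 choose d-1).
  Reconciling the two is the delicate point: the stated constant offers a factor 2 at the low norm
  of F but only 1 at the high norm, and a, b must fit both. The hypothesis on N gives finite moments
  of |A_q| |p_q|^b up to b = m + 1, the highest power in the commutator.\<close>

definition ell2 :: "('k \<Rightarrow> 'a::real_normed_vector) \<Rightarrow> bool" where
  "ell2 u \<longleftrightarrow> (\<lambda>k. (norm (u k))\<^sup>2) summable_on UNIV"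

text \<open>A divergent sum has the default value 0, so this is a norm only together with
  \<open>ell2\<close>. Both apply to plain functions, because weighted families such as r^s u are
  written down before they are known to be square summable.\<close>

definition ell2_norm :: "('k \<Rightarrow> 'a::real_normed_vector) \<Rightarrow> real" where
  "ell2_norm u = sqrt (\<Sum>\<^sub>\<infinity>k. (norm (u k))\<^sup>2)"

lemma ell2_norm_nonneg [simp]: "0 \<le> ell2_norm u"
  unfolding ell2_norm_def by (intro real_sqrt_ge_zero infsum_nonneg) auto

lemma ell2_norm_power2: "(ell2_norm u)\<^sup>2 = (\<Sum>\<^sub>\<infinity>k. (norm (u k))\<^sup>2)"
  unfolding ell2_norm_def by (intro real_sqrt_pow2 infsum_nonneg) auto

lemma L2_set_le_ell2_norm:
  assumes "ell2 u"
  shows "L2_set (\<lambda>k. norm (u k)) S \<le> ell2_norm u"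
proof (cases "finite S")
  case True
  then have "(\<Sum>k\<in>S. (norm (u k))\<^sup>2) \<le> (\<Sum>\<^sub>\<infinity>k. (norm (u k))\<^sup>2)"
    using assms unfolding ell2_def by (intro finite_sum_le_infsum) auto
  then show ?thesis
    unfolding L2_set_def ell2_norm_def by simp
qed simp

lemma norm_le_ell2_norm:
  assumes "ell2 u"
  shows "norm (u k) \<le> ell2_norm u"
  using L2_set_le_ell2_norm[OF assms, of "{k}"] by simp

text \<open>Transfers Minkowski and Cauchy-Schwarz from \<open>L2_set\<close>. It also does the work
  of completeness: if finite sections converge coordinatewise under a common bound, the limit obeys
  the same bound.\<close>

lemma ell2_bounded:
  assumes "\<And>S. finite S \<Longrightarrow> L2_set (\<lambda>k. norm (u k)) S \<le> C"
  shows "ell2 u" "ell2_norm u \<le> C"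
proof -
  have C: "0 \<le> C" using assms[of "{}"] by simp
  have le: "(\<Sum>k\<in>S. (norm (u k))\<^sup>2) \<le> C\<^sup>2" if "finite S" for S
  proof -
    have "(\<Sum>k\<in>S. (norm (u k))\<^sup>2) = (L2_set (\<lambda>k. norm (u k)) S)\<^sup>2"
      unfolding L2_set_def by (simp add: sum_nonneg)
    also have "\<dots> \<le> C\<^sup>2"
      using assms[OF that] by (intro power_mono) auto
    finally show ?thesis .
  qed
  show "ell2 u"
    unfolding ell2_def
    by (rule nonneg_bdd_above_summable_on) (auto intro!: bdd_aboveI2[where M = "C\<^sup>2"] le)
  then have "(\<Sum>\<^sub>\<infinity>k. (norm (u k))\<^sup>2) \<le> C\<^sup>2"
    unfolding ell2_def by (rule infsum_le_finite_sums) (auto intro: le)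
  then have "ell2_norm u \<le> sqrt (C\<^sup>2)"
    unfolding ell2_norm_def by (rule real_sqrt_le_mono)
  then show "ell2_norm u \<le> C" using C by simp
qed

lemma ell2_mono:
  assumes "ell2 v" "\<And>k. norm (u k) \<le> norm (v k)"
  shows "ell2 u" "ell2_norm u \<le> ell2_norm v"
proof -
  have "L2_set (\<lambda>k. norm (u k)) S \<le> ell2_norm v" if "finite S" for S
    using L2_set_le_ell2_norm[OF assms(1), of S]
      L2_set_mono[of S "\<lambda>k. norm (u k)" "\<lambda>k. norm (v k)"] assms(2) by fastforce
  from ell2_bounded[of u, OF this] show "ell2 u" "ell2_norm u \<le> ell2_norm v" by auto
qed

lemma ell2_add:
  assumes "ell2 u" "ell2 v"
  shows "ell2 (\<lambda>k. u k + v k)" "ell2_norm (\<lambda>k. u k + v k) \<le> ell2_norm u + ell2_norm v"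
proof -
  have *: "L2_set (\<lambda>k. norm (u k + v k)) S \<le> ell2_norm u + ell2_norm v" if "finite S" for S
  proof -
    have "L2_set (\<lambda>k. norm (u k + v k)) S \<le> L2_set (\<lambda>k. norm (u k) + norm (v k)) S"
      by (rule L2_set_mono) (auto simp: norm_triangle_ineq)
    also have "\<dots> \<le> L2_set (\<lambda>k. norm (u k)) S + L2_set (\<lambda>k. norm (v k)) S"
      by (rule L2_set_triangle_ineq)
    also have "\<dots> \<le> ell2_norm u + ell2_norm v"
      using L2_set_le_ell2_norm assms by (intro add_mono) auto
    finally show ?thesis .
  qed
  from ell2_bounded[of "\<lambda>k. u k + v k", OF *] show "ell2 (\<lambda>k. u k + v k)"
    "ell2_norm (\<lambda>k. u k + v k) \<le> ell2_norm u + ell2_norm v" by auto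
qed

lemma ell2_zero [simp]: "ell2 (\<lambda>k. 0)" "ell2_norm (\<lambda>k. 0) = 0"
  by (simp_all add: ell2_def ell2_norm_def)

lemma ell2_cmult:
  fixes u :: "'k \<Rightarrow> 'a::real_normed_div_algebra"
  assumes "ell2 u"
  shows "ell2 (\<lambda>k. c * u k)" "ell2_norm (\<lambda>k. c * u k) = norm c * ell2_norm u"
proof -
  show "ell2 (\<lambda>k. c * u k)"
    using assms unfolding ell2_def
    by (simp add: norm_mult power_mult_distrib summable_on_cmult_right)
  show "ell2_norm (\<lambda>k. c * u k) = norm c * ell2_norm u"
    using assms unfolding ell2_def ell2_norm_def
    by (simp add: norm_mult power_mult_distrib infsum_cmult_right real_sqrt_mult)
qed

lemma ell2_diff:
  fixes u v :: "'k \<Rightarrow> 'a::real_normed_vector"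
  assumes "ell2 u" "ell2 v"
  shows "ell2 (\<lambda>k. u k - v k)" "ell2_norm (\<lambda>k. u k - v k) \<le> ell2_norm u + ell2_norm v"
proof -
  have "ell2 (\<lambda>k. - v k)" "ell2_norm (\<lambda>k. - v k) = ell2_norm v"
    using assms(2) by (simp_all add: ell2_def ell2_norm_def)
  then show "ell2 (\<lambda>k. u k - v k)" "ell2_norm (\<lambda>k. u k - v k) \<le> ell2_norm u + ell2_norm v"
    using ell2_add[OF assms(1), of "\<lambda>k. - v k"] by simp_all
qed

lemma ell2_sum:
  assumes "finite I" "\<And>i. i \<in> I \<Longrightarrow> ell2 (u i)"
  shows "ell2 (\<lambda>k. \<Sum>i\<in>I. u i k)" "ell2_norm (\<lambda>k. \<Sum>i\<in>I. u i k) \<le> (\<Sum>i\<in>I. ell2_norm (u i))"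
proof -
  have "ell2 (\<lambda>k. \<Sum>i\<in>I. u i k) \<and> ell2_norm (\<lambda>k. \<Sum>i\<in>I. u i k) \<le> (\<Sum>i\<in>I. ell2_norm (u i))"
    using assms
  proof (induction I)
    case (insert x I)
    then have IH: "ell2 (\<lambda>k. \<Sum>i\<in>I. u i k)"
      "ell2_norm (\<lambda>k. \<Sum>i\<in>I. u i k) \<le> (\<Sum>i\<in>I. ell2_norm (u i))" by auto
    show ?case
      using insert(1,2) ell2_add[of "u x" "\<lambda>k. \<Sum>i\<in>I. u i k"] insert(4)[of x] IH by auto
  qed auto
  then show "ell2 (\<lambda>k. \<Sum>i\<in>I. u i k)"
    "ell2_norm (\<lambda>k. \<Sum>i\<in>I. u i k) \<le> (\<Sum>i\<in>I. ell2_norm (u i))" by auto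
qed

section \<open>Inner product of square summable complex families\<close>

lemma ell2_mult_summable:
  fixes u v :: "'k \<Rightarrow> complex"
  assumes "ell2 u" "ell2 v"
  shows "(\<lambda>k. u k * cnj (v k)) summable_on UNIV"
    and "norm (\<Sum>\<^sub>\<infinity>k. u k * cnj (v k)) \<le> ell2_norm u * ell2_norm v"
proof -
  have le: "(\<Sum>k\<in>S. norm (u k * cnj (v k))) \<le> ell2_norm u * ell2_norm v" for S
  proof -
    have "(\<Sum>k\<in>S. norm (u k * cnj (v k))) \<le>
        L2_set (\<lambda>k. norm (u k)) S * L2_set (\<lambda>k. norm (v k)) S"
      using L2_set_mult_ineq[of "\<lambda>k. norm (u k)" "\<lambda>k. norm (v k)" S] by (simp add: norm_mult)
    also have "\<dots> \<le> ell2_norm u * ell2_norm v"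
      by (intro mult_mono L2_set_le_ell2_norm assms) auto
    finally show ?thesis .
  qed
  have abs: "(\<lambda>k. norm (u k * cnj (v k))) summable_on UNIV"
    by (rule nonneg_bdd_above_summable_on) (auto intro!: bdd_aboveI2 le)
  then show "(\<lambda>k. u k * cnj (v k)) summable_on UNIV"
    by (rule abs_summable_summable)
  have "norm (\<Sum>\<^sub>\<infinity>k. u k * cnj (v k)) \<le> (\<Sum>\<^sub>\<infinity>k. norm (u k * cnj (v k)))"
    using abs by (rule norm_infsum_bound)
  also have "\<dots> \<le> ell2_norm u * ell2_norm v"
    using abs by (rule infsum_le_finite_sums) (auto intro: le)
  finally show "norm (\<Sum>\<^sub>\<infinity>k. u k * cnj (v k)) \<le> ell2_norm u * ell2_norm v" .
qed

definition ell2_inner :: "('k \<Rightarrow> complex) \<Rightarrow> ('k \<Rightarrow> complex) \<Rightarrow> complex" where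
  "ell2_inner u v = (\<Sum>\<^sub>\<infinity>k. u k * cnj (v k))"

lemma norm_ell2_inner_le:
  "ell2 u \<Longrightarrow> ell2 v \<Longrightarrow> norm (ell2_inner u v) \<le> ell2_norm u * ell2_norm v"
  unfolding ell2_inner_def by (rule ell2_mult_summable)

lemma ell2_inner_add_left:
  "ell2 u \<Longrightarrow> ell2 u' \<Longrightarrow> ell2 v \<Longrightarrow>
    ell2_inner (\<lambda>k. u k + u' k) v = ell2_inner u v + ell2_inner u' v"
  unfolding ell2_inner_def by (simp add: distrib_right infsum_add ell2_mult_summable)

lemma ell2_inner_diff_left:
  assumes "ell2 u" "ell2 u'" "ell2 v"
  shows "ell2_inner (\<lambda>k. u k - u' k) v = ell2_inner u v - ell2_inner u' v"
  using ell2_inner_add_left[OF ell2_diff(1)[OF assms(1,2)] assms(2,3)] by simp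

lemma ell2_inner_commute: "ell2_inner u v = cnj (ell2_inner v u)"
  unfolding ell2_inner_def by (simp flip: infsum_cnj add: mult.commute)

lemma ell2_inner_diff_right:
  assumes "ell2 u" "ell2 v" "ell2 v'"
  shows "ell2_inner u (\<lambda>k. v k - v' k) = ell2_inner u v - ell2_inner u v'"
  using ell2_inner_diff_left[OF assms(2,3,1)]
  by (simp add: ell2_inner_commute[of u])

lemma ell2_inner_cmult_left: "ell2_inner (\<lambda>k. c * u k) v = c * ell2_inner u v"
  unfolding ell2_inner_def by (simp add: infsum_cmult_right' mult.assoc)

lemma ell2_inner_self:
  assumes "ell2 u"
  shows "ell2_inner u u = complex_of_real ((ell2_norm u)\<^sup>2)"
proof -
  have "((\<lambda>k. complex_of_real ((norm (u k))\<^sup>2)) has_sum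
      complex_of_real (\<Sum>\<^sub>\<infinity>k. (norm (u k))\<^sup>2)) UNIV"
    using assms unfolding ell2_def by (intro has_sum_of_real has_sum_infsum)
  from infsumI[OF this] show ?thesis
    unfolding ell2_inner_def ell2_norm_power2 by (simp only: complex_norm_square)
qed

text \<open>Meant for v - \<rho> T v: the arguments of the cross term are ordered so that it becomes
  \<rho> Re <T v, v>, the quantity bounded below by coercivity.\<close>

lemma ell2_norm_diff_power2:
  assumes "ell2 u" "ell2 v"
  shows "(ell2_norm (\<lambda>k. u k - v k))\<^sup>2 =
    (ell2_norm u)\<^sup>2 - 2 * Re (ell2_inner v u) + (ell2_norm v)\<^sup>2"
proof -
  have "complex_of_real ((ell2_norm (\<lambda>k. u k - v k))\<^sup>2) =
      ell2_inner u u - ell2_inner u v - (ell2_inner v u - ell2_inner v v)"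
    using assms
    by (simp add: ell2_inner_self[symmetric] ell2_inner_diff_left ell2_inner_diff_right ell2_diff
        del: of_real_power)
  also have "Re \<dots> = (ell2_norm u)\<^sup>2 - 2 * Re (ell2_inner v u) + (ell2_norm v)\<^sup>2"
    using assms by (simp add: ell2_inner_self ell2_inner_commute[of u v] del: of_real_power)
  finally show ?thesis
    by (metis Re_complex_of_real)
qed

section \<open>Truncation to finite index sets\<close>

lemma ell2_truncate:
  fixes u :: "'k \<Rightarrow> 'a::real_normed_vector"
  assumes "ell2 u"
  shows "ell2 (\<lambda>k. if k \<in> S then u k else 0)"
    "ell2_norm (\<lambda>k. if k \<in> S then u k else 0) \<le> ell2_norm u"
  using ell2_mono[OF assms, of "\<lambda>k. if k \<in> S then u k else 0"] by auto

lemma ell2_norm_tail_power2: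
  assumes "ell2 u" "finite S"
  shows "(ell2_norm (\<lambda>k. u k - (if k \<in> S then u k else 0)))\<^sup>2 =
    (\<Sum>\<^sub>\<infinity>k. (norm (u k))\<^sup>2) - (\<Sum>k\<in>S. (norm (u k))\<^sup>2)"
proof -
  have "(\<lambda>k. (norm (u k))\<^sup>2) summable_on S" "(\<lambda>k. (norm (u k))\<^sup>2) summable_on - S"
    using assms summable_on_subset_banach unfolding ell2_def by auto
  then have "(\<Sum>\<^sub>\<infinity>k. (norm (u k))\<^sup>2) = (\<Sum>\<^sub>\<infinity>k\<in>S. (norm (u k))\<^sup>2) + (\<Sum>\<^sub>\<infinity>k\<in>-S. (norm (u k))\<^sup>2)"
    by (subst infsum_Un_disjoint[symmetric]) auto
  moreover have "(\<Sum>\<^sub>\<infinity>k. (norm (u k - (if k \<in> S then u k else 0)))\<^sup>2) = (\<Sum>\<^sub>\<infinity>k\<in>-S. (norm (u k))\<^sup>2)"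
    by (rule infsum_cong_neutral) auto
  ultimately show ?thesis using assms(2) by (simp add: ell2_norm_power2)
qed

lemma ell2_truncate_tendsto:
  assumes "ell2 u"
  shows "((\<lambda>S. ell2_norm (\<lambda>k. u k - (if k \<in> S then u k else 0))) \<longlongrightarrow> 0)
    (finite_subsets_at_top UNIV)"
proof -
  have "((\<lambda>S. \<Sum>k\<in>S. (norm (u k))\<^sup>2) \<longlongrightarrow> (\<Sum>\<^sub>\<infinity>k. (norm (u k))\<^sup>2)) (finite_subsets_at_top UNIV)"
    using assms unfolding ell2_def by (rule infsum_tendsto)
  then have "((\<lambda>S. (\<Sum>\<^sub>\<infinity>k. (norm (u k))\<^sup>2) - (\<Sum>k\<in>S. (norm (u k))\<^sup>2)) \<longlongrightarrow>
      (\<Sum>\<^sub>\<infinity>k. (norm (u k))\<^sup>2) - (\<Sum>\<^sub>\<infinity>k. (norm (u k))\<^sup>2)) (finite_subsets_at_top UNIV)"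
    by (intro tendsto_intros)
  moreover have "eventually (\<lambda>S. (\<Sum>\<^sub>\<infinity>k. (norm (u k))\<^sup>2) - (\<Sum>k\<in>S. (norm (u k))\<^sup>2) =
      (ell2_norm (\<lambda>k. u k - (if k \<in> S then u k else 0)))\<^sup>2) (finite_subsets_at_top UNIV)"
    by (rule eventually_finite_subsets_at_top_weakI) (simp add: ell2_norm_tail_power2[OF assms])
  ultimately have "((\<lambda>S. (ell2_norm (\<lambda>k. u k - (if k \<in> S then u k else 0)))\<^sup>2) \<longlongrightarrow> 0)
      (finite_subsets_at_top UNIV)"
    by (simp add: tendsto_cong)
  then have "((\<lambda>S. sqrt ((ell2_norm (\<lambda>k. u k - (if k \<in> S then u k else 0)))\<^sup>2)) \<longlongrightarrow> sqrt 0)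
      (finite_subsets_at_top UNIV)"
    by (intro tendsto_intros)
  then show ?thesis by simp
qed

text \<open>Young's inequality. After the substitution q = k - l the convolution is a combination of
  translates of u with weights a q, and translation preserves the norm, so Minkowski gives the bound
  for finitely many q. The limit in q is taken on a fixed finite section S, where it is a limit of
  finitely many numbers.\<close>

lemma ell2_convolution:
  fixes a u :: "'k::ab_group_add \<Rightarrow> real"
  assumes a: "a summable_on UNIV" "\<And>q. 0 \<le> a q" and u: "ell2 u" "\<And>k. 0 \<le> u k"
  shows "(\<lambda>l. a (k - l) * u l) summable_on UNIV"
    and "ell2 (\<lambda>k. \<Sum>\<^sub>\<infinity>l. a (k - l) * u l)"
    and "ell2_norm (\<lambda>k. \<Sum>\<^sub>\<infinity>l. a (k - l) * u l) \<le> infsum a UNIV * ell2_norm u"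
proof -
  have bij: "bij (\<lambda>q. k - q)" for k :: 'k
    by (rule bijI') (auto intro: exI[of _ "k - _"] simp: algebra_simps)
  have ul: "u l \<le> ell2_norm u" for l
    using norm_le_ell2_norm[OF u(1), of l] by simp
  have s: "(\<lambda>q. a q * u (k - q)) summable_on UNIV" for k
    by (rule summable_on_comparison_test[where f = "\<lambda>q. a q * ell2_norm u"])
      (auto intro!: summable_on_cmult_left a mult_left_mono ul mult_nonneg_nonneg u)
  have e: "(\<Sum>\<^sub>\<infinity>l. a (k - l) * u l) = (\<Sum>\<^sub>\<infinity>q. a q * u (k - q))" for k
    using infsum_reindex_bij_betw[OF bij[of k], of "\<lambda>q. a q * u (k - q)"] by simp
  show "(\<lambda>l. a (k - l) * u l) summable_on UNIV" for k
    using summable_on_reindex_bij_betw[OF bij[of k], of "\<lambda>q. a q * u (k - q)"] s[of k] by simp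
  have fin: "L2_set (\<lambda>k. \<Sum>q\<in>Q. a q * u (k - q)) S \<le> infsum a UNIV * ell2_norm u"
    if "finite Q" "finite S" for Q S
  proof -
    have "L2_set (\<lambda>k. \<Sum>q\<in>Q. a q * u (k - q)) S \<le> (\<Sum>q\<in>Q. L2_set (\<lambda>k. a q * u (k - q)) S)"
      using that(1)
    proof (induction Q)
      case empty
      then show ?case by (simp add: L2_set_0')
    next
      case (insert x Q)
      have "L2_set (\<lambda>k. \<Sum>q\<in>insert x Q. a q * u (k - q)) S =
          L2_set (\<lambda>k. a x * u (k - x) + (\<Sum>q\<in>Q. a q * u (k - q))) S"
        using insert by simp
      also have "\<dots> \<le> L2_set (\<lambda>k. a x * u (k - x)) S + L2_set (\<lambda>k. \<Sum>q\<in>Q. a q * u (k - q)) S"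
        by (rule L2_set_triangle_ineq)
      finally show ?case using insert by simp
    qed
    also have "\<dots> \<le> (\<Sum>q\<in>Q. a q * ell2_norm u)"
    proof (rule sum_mono)
      fix q
      have "L2_set (\<lambda>k. u (k - q)) S = L2_set (\<lambda>k. norm (u k)) ((\<lambda>k. k - q) ` S)"
        unfolding L2_set_def by (subst sum.reindex) (auto simp: inj_on_def)
      also have "\<dots> \<le> ell2_norm u" by (rule L2_set_le_ell2_norm[OF u(1)])
      finally show "L2_set (\<lambda>k. a q * u (k - q)) S \<le> a q * ell2_norm u"
        using a(2)[of q] by (simp add: L2_set_right_distrib[symmetric] mult_left_mono)
    qed
    also have "\<dots> = (\<Sum>q\<in>Q. a q) * ell2_norm u" by (simp add: sum_distrib_right)
    also have "\<dots> \<le> infsum a UNIV * ell2_norm u"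
      using that a by (intro mult_right_mono finite_sum_le_infsum) auto
    finally show ?thesis .
  qed
  have "L2_set (\<lambda>k. norm (\<Sum>\<^sub>\<infinity>l. a (k - l) * u l)) S \<le> infsum a UNIV * ell2_norm u"
    if S: "finite S" for S
  proof -
    have nn: "0 \<le> (\<Sum>\<^sub>\<infinity>q. a q * u (k - q))" for k
      by (intro infsum_nonneg mult_nonneg_nonneg a u)
    have "((\<lambda>Q. L2_set (\<lambda>k. \<Sum>q\<in>Q. a q * u (k - q)) S) \<longlongrightarrow>
        L2_set (\<lambda>k. \<Sum>\<^sub>\<infinity>q. a q * u (k - q)) S) (finite_subsets_at_top UNIV)"
      unfolding L2_set_def by (intro tendsto_intros infsum_tendsto s)
    then have "L2_set (\<lambda>k. \<Sum>\<^sub>\<infinity>q. a q * u (k - q)) S \<le> infsum a UNIV * ell2_norm u"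
      by (rule tendsto_upperbound)
        (auto intro!: eventually_finite_subsets_at_top_weakI fin S)
    then show ?thesis using nn by (simp add: e)
  qed
  from ell2_bounded[of "\<lambda>k. \<Sum>\<^sub>\<infinity>l. a (k - l) * u l", OF this]
  show "ell2 (\<lambda>k. \<Sum>\<^sub>\<infinity>l. a (k - l) * u l)"
    "ell2_norm (\<lambda>k. \<Sum>\<^sub>\<infinity>l. a (k - l) * u l) \<le> infsum a UNIV * ell2_norm u" by auto
qed

lemma ell2_norm_cong: "(\<And>k. norm (u k) = norm (v k)) \<Longrightarrow> ell2_norm u = ell2_norm v"
  unfolding ell2_norm_def by simp

lemma ell2_cong: "(\<And>k. norm (u k) = norm (v k)) \<Longrightarrow> ell2 u = ell2 v"
  unfolding ell2_def by simp

lemma ell2_finite_support: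
  assumes "finite S" "\<And>k. k \<notin> S \<Longrightarrow> u k = 0"
  shows "ell2 u"
  unfolding ell2_def
  by (rule finite_nonzero_values_imp_summable_on) (rule finite_subset[OF _ assms(1)], use assms in auto)

text \<open>The pointwise inequality is applied at x = r k and multiplied by |f k|. The weights a, b
  stay free because the final constants depend on them; the exponent 0 is left visible so that all
  weighted families have the shape r^s |f|.\<close>

lemma ell2_interpolate:
  fixes r :: "'k \<Rightarrow> real" and f :: "'k \<Rightarrow> complex"
  assumes r: "\<And>k. 0 \<le> r k" and "0 \<le> a" "0 \<le> b" and le: "\<And>x. 0 \<le> x \<Longrightarrow> x ^ j \<le> a + b * x ^ s"
    and f: "ell2 (\<lambda>k. r k ^ 0 * norm (f k))" "ell2 (\<lambda>k. r k ^ s * norm (f k))"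
  shows "ell2 (\<lambda>k. r k ^ j * norm (f k))"
    and "ell2_norm (\<lambda>k. r k ^ j * norm (f k)) \<le>
      a * ell2_norm (\<lambda>k. r k ^ 0 * norm (f k)) + b * ell2_norm (\<lambda>k. r k ^ s * norm (f k))"
proof -
  note sum = ell2_add[OF ell2_cmult(1)[OF f(1), of a] ell2_cmult(1)[OF f(2), of b]]
  have "norm (r k ^ j * norm (f k)) \<le> norm (a * (r k ^ 0 * norm (f k)) + b * (r k ^ s * norm (f k)))" for k
  proof -
    have "r k ^ j * norm (f k) \<le> (a + b * r k ^ s) * norm (f k)"
      by (intro mult_right_mono le r) auto
    moreover have "0 \<le> r k ^ j * norm (f k)" using r by simp
    ultimately show ?thesis by (simp add: algebra_simps)
  qed
  note le = ell2_mono[OF sum(1) this]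
  show "ell2 (\<lambda>k. r k ^ j * norm (f k))" by (rule le(1))
  show "ell2_norm (\<lambda>k. r k ^ j * norm (f k)) \<le>
      a * ell2_norm (\<lambda>k. r k ^ 0 * norm (f k)) + b * ell2_norm (\<lambda>k. r k ^ s * norm (f k))"
    using order_trans[OF le(2) sum(2)] assms(2,3) by (simp only: ell2_cmult f real_norm_def abs_of_nonneg)
qed


section \<open>Coercive matrices dominated by a convolution\<close>

text \<open>Binomial expansion of max^s = (min + |x - y|)^s around the smaller number. Since the
  minimum is at most y whichever number is larger, only powers of y appear, and y is the value
  attached to the column index in the commutator.\<close>

lemma power_diff_le_binomial_sum:
  fixes x y c :: real
  assumes "0 \<le> x" "0 \<le> y" "\<bar>x - y\<bar> \<le> c"
  shows "\<bar>x ^ s - y ^ s\<bar> \<le> (\<Sum>j<s. real (s choose j) * y ^ j * c ^ (s - j))"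
proof -
  define t where "t = min x y"
  define e where "e = \<bar>x - y\<bar>"
  have e: "0 \<le> e" "e \<le> c" and t: "0 \<le> t" "t \<le> y"
    using assms by (auto simp: e_def t_def)
  have te: "t + e = max x y"
    by (auto simp: t_def e_def)
  have "\<bar>x ^ s - y ^ s\<bar> = (t + e) ^ s - t ^ s"
    unfolding te using power_mono[of x y s] power_mono[of y x s] assms
    by (auto simp: t_def max_def min_def)
  also have "\<dots> = (\<Sum>j<s. real (s choose j) * t ^ j * e ^ (s - j))"
    by (simp add: binomial_ring lessThan_Suc_atMost[symmetric])
  also have "\<dots> \<le> (\<Sum>j<s. real (s choose j) * y ^ j * c ^ (s - j))"
    using e t by (intro sum_mono mult_mono power_mono) auto
  finally show ?thesis .
qed

lemma has_sum_sum:
  fixes f :: "'j \<Rightarrow> 'k \<Rightarrow> 'a::topological_comm_monoid_add"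
  assumes "finite J" "\<And>j. j \<in> J \<Longrightarrow> (f j has_sum s j) A"
  shows "((\<lambda>x. \<Sum>j\<in>J. f j x) has_sum (\<Sum>j\<in>J. s j)) A"
  using assms by (induction J) (auto intro: has_sum_add)

text \<open>The index set is a group so that entries can be dominated by a function of k - l.
  Coercivity is assumed on finite sections, where it is a statement about trigonometric polynomials,
  and away from 0, because e_0 = 0 makes row 0 vanish.\<close>

locale coercive_matrix =
  fixes a :: "'k::ab_group_add \<Rightarrow> real" and h :: "'k \<Rightarrow> 'k \<Rightarrow> complex" and \<alpha> :: real
  assumes a_summable: "a summable_on UNIV"
    and a_nonneg: "0 \<le> a q"
    and h_le: "norm (h k l) \<le> a (k - l)"
    and h_zero: "h 0 l = 0"
    and \<alpha>_pos: "0 < \<alpha>"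
    and coercive_finite: "finite S \<Longrightarrow> 0 \<notin> S \<Longrightarrow>
      \<alpha> * (\<Sum>k\<in>S. (norm (u k))\<^sup>2) \<le> Re (\<Sum>k\<in>S. \<Sum>l\<in>S. h k l * u l * cnj (u k))"
begin

definition app :: "('k \<Rightarrow> complex) \<Rightarrow> 'k \<Rightarrow> complex" where
  "app u k = (\<Sum>\<^sub>\<infinity>l. h k l * u l)"

lemma app_summable:
  assumes "ell2 u"
  shows "(\<lambda>l. norm (h k l * u l)) summable_on UNIV"
proof -
  have "(\<lambda>l. a (k - l) * norm (u l)) summable_on UNIV"
    using assms by (intro ell2_convolution a_summable a_nonneg) (auto simp: ell2_def)
  then show ?thesis
    by (rule summable_on_comparison_test)
      (auto simp: norm_mult h_le intro!: mult_right_mono)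
qed

lemma app_has_sum: "ell2 u \<Longrightarrow> ((\<lambda>l. h k l * u l) has_sum app u k) UNIV"
  unfolding app_def using abs_summable_summable[OF app_summable] by (rule has_sum_infsum)

lemma app_bounded:
  assumes "ell2 u"
  shows "ell2 (app u)" "ell2_norm (app u) \<le> infsum a UNIV * ell2_norm u"
proof -
  have u: "ell2 (\<lambda>k. norm (u k))" "ell2_norm (\<lambda>k. norm (u k)) = ell2_norm u"
    using assms by (simp_all add: ell2_def ell2_norm_def)
  note conv = ell2_convolution[OF a_summable a_nonneg u(1) norm_ge_zero]
  have "norm (app u k) \<le> (\<Sum>\<^sub>\<infinity>l. a (k - l) * norm (u l))" for k
    by (rule norm_infsum_le[OF app_has_sum[OF assms] has_sum_infsum[OF conv(1)]])
      (auto simp: norm_mult h_le intro!: mult_right_mono)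
  then have "norm (app u k) \<le> norm (\<Sum>\<^sub>\<infinity>l. a (k - l) * norm (u l))" for k
    by (simp add: order_trans[OF _ abs_ge_self])
  from ell2_mono[OF conv(2) this] conv(3) u(2)
  show "ell2 (app u)" "ell2_norm (app u) \<le> infsum a UNIV * ell2_norm u" by auto
qed

lemma app_diff:
  assumes "ell2 u" "ell2 v"
  shows "app (\<lambda>k. u k - v k) k = app u k - app v k"
proof -
  have "((\<lambda>l. h k l * u l + - (h k l * v l)) has_sum (app u k + - app v k)) UNIV"
    using assms by (intro has_sum_add has_sum_uminusI app_has_sum)
  from infsumI[OF this] show ?thesis
    unfolding app_def[of "\<lambda>k. u k - v k"] by (simp add: right_diff_distrib)
qed

lemma app_at_zero: "app u 0 = 0"
  unfolding app_def by (simp add: h_zero)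

lemma form_finite:
  assumes "finite S"
  shows "ell2_inner (app (\<lambda>k. if k \<in> S then u k else 0)) (\<lambda>k. if k \<in> S then v k else 0) =
    (\<Sum>k\<in>S. \<Sum>l\<in>S. h k l * u l * cnj (v k))"
proof -
  have "app (\<lambda>k. if k \<in> S then u k else 0) k = (\<Sum>l\<in>S. h k l * u l)" for k
  proof -
    have "app (\<lambda>k. if k \<in> S then u k else 0) k = (\<Sum>\<^sub>\<infinity>l\<in>S. h k l * u l)"
      unfolding app_def by (rule infsum_cong_neutral) auto
    then show ?thesis using assms by simp
  qed
  then have "ell2_inner (app (\<lambda>k. if k \<in> S then u k else 0)) (\<lambda>k. if k \<in> S then v k else 0) =
      (\<Sum>\<^sub>\<infinity>k. (\<Sum>l\<in>S. h k l * u l) * cnj (if k \<in> S then v k else 0))"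
    by (simp add: ell2_inner_def)
  also have "\<dots> = (\<Sum>\<^sub>\<infinity>k\<in>S. (\<Sum>l\<in>S. h k l * u l) * cnj (v k))"
    by (rule infsum_cong_neutral) auto
  finally show ?thesis using assms by (simp add: sum_distrib_right)
qed

text \<open>Truncating both arguments changes the form by <T(u - u_S), v_S> + <T u, v - v_S>, and T
  is bounded. This is the bridge between finite sums, where Fourier computations take place, and the
  form itself.\<close>

lemma form_tendsto:
  assumes u: "ell2 u" and v: "ell2 v"
  shows "((\<lambda>S. \<Sum>k\<in>S. \<Sum>l\<in>S. h k l * u l * cnj (v k)) \<longlongrightarrow> ell2_inner (app u) v)
    (finite_subsets_at_top UNIV)"
proof -
  define T where "T S w = (\<lambda>k. if k \<in> S then w k else 0)" for S :: "'k set" and w :: "'k \<Rightarrow> complex"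
  define L where "L = infsum a UNIV"
  have T: "ell2 (T S w)" "ell2_norm (T S w) \<le> ell2_norm w" if "ell2 w" for S w
    unfolding T_def using ell2_truncate[OF that] by auto
  have lim: "((\<lambda>S. ell2_norm (\<lambda>k. w k - T S w k)) \<longlongrightarrow> 0) (finite_subsets_at_top UNIV)"
    if "ell2 w" for w
    unfolding T_def by (rule ell2_truncate_tendsto[OF that])
  have bound: "norm (ell2_inner (app (T S u)) (T S v) - ell2_inner (app u) v) \<le>
      L * ell2_norm (\<lambda>k. u k - T S u k) * ell2_norm v
        + L * ell2_norm u * ell2_norm (\<lambda>k. v k - T S v k)" for S
  proof -
    have 1: "ell2_inner (app u) (T S v) - ell2_inner (app (T S u)) (T S v) =
        ell2_inner (app (\<lambda>k. u k - T S u k)) (T S v)"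
    proof -
      have "app (\<lambda>k. u k - T S u k) = (\<lambda>k. app u k - app (T S u) k)"
        using app_diff[OF u T(1)[OF u]] by blast
      then show ?thesis using u v T by (simp add: app_bounded ell2_inner_diff_left)
    qed
    have 2: "ell2_inner (app u) v - ell2_inner (app u) (T S v) =
        ell2_inner (app u) (\<lambda>k. v k - T S v k)"
      using u v T by (simp add: app_bounded ell2_inner_diff_right)
    have "norm (ell2_inner (app (T S u)) (T S v) - ell2_inner (app u) v) =
        norm (ell2_inner (app (\<lambda>k. u k - T S u k)) (T S v) + ell2_inner (app u) (\<lambda>k. v k - T S v k))"
      by (subst norm_minus_commute) (simp add: 1[symmetric] 2[symmetric])
    also have "\<dots> \<le> ell2_norm (app (\<lambda>k. u k - T S u k)) * ell2_norm (T S v) +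
        ell2_norm (app u) * ell2_norm (\<lambda>k. v k - T S v k)"
      using u v T by (intro norm_triangle_le add_mono norm_ell2_inner_le app_bounded ell2_diff) auto
    also have "\<dots> \<le> L * ell2_norm (\<lambda>k. u k - T S u k) * ell2_norm v
        + L * ell2_norm u * ell2_norm (\<lambda>k. v k - T S v k)"
      unfolding L_def using u v T
      by (intro add_mono mult_mono app_bounded ell2_diff mult_nonneg_nonneg infsum_nonneg a_nonneg) auto
    finally show ?thesis .
  qed
  have "((\<lambda>S. L * ell2_norm (\<lambda>k. u k - T S u k) * ell2_norm v
      + L * ell2_norm u * ell2_norm (\<lambda>k. v k - T S v k)) \<longlongrightarrow>
      L * 0 * ell2_norm v + L * ell2_norm u * 0) (finite_subsets_at_top UNIV)"
    by (intro tendsto_intros lim u v)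
  then have "((\<lambda>S. L * ell2_norm (\<lambda>k. u k - T S u k) * ell2_norm v
      + L * ell2_norm u * ell2_norm (\<lambda>k. v k - T S v k)) \<longlongrightarrow> 0) (finite_subsets_at_top UNIV)"
    by simp
  then have "((\<lambda>S. ell2_inner (app (T S u)) (T S v) - ell2_inner (app u) v) \<longlongrightarrow> 0)
      (finite_subsets_at_top UNIV)"
    by (rule Lim_null_comparison[rotated]) (simp add: bound)
  then have "((\<lambda>S. ell2_inner (app (T S u)) (T S v)) \<longlongrightarrow> ell2_inner (app u) v)
      (finite_subsets_at_top UNIV)"
    by (rule LIM_zero_cancel)
  moreover have "eventually (\<lambda>S. ell2_inner (app (T S u)) (T S v) =
      (\<Sum>k\<in>S. \<Sum>l\<in>S. h k l * u l * cnj (v k))) (finite_subsets_at_top UNIV)"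
    unfolding T_def by (intro eventually_finite_subsets_at_top_weakI form_finite) 
  ultimately show ?thesis
    by (simp add: tendsto_cong)
qed

text \<open>Limit of the finite-section inequality. Those sections must avoid 0, and u 0 = 0 allows
  that index to be removed from each S without changing the sums.\<close>

lemma coercive:
  assumes u: "ell2 u" "u 0 = 0"
  shows "\<alpha> * (ell2_norm u)\<^sup>2 \<le> Re (ell2_inner (app u) u)"
proof (rule tendsto_le[OF _ tendsto_Re[OF form_tendsto[OF u(1) u(1)]]])
  show "((\<lambda>S. \<alpha> * (\<Sum>k\<in>S. (norm (u k))\<^sup>2)) \<longlongrightarrow> \<alpha> * (ell2_norm u)\<^sup>2) (finite_subsets_at_top UNIV)"
    using u unfolding ell2_norm_power2 ell2_def by (intro tendsto_intros infsum_tendsto)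
  have "\<alpha> * (\<Sum>k\<in>S. (norm (u k))\<^sup>2) \<le> Re (\<Sum>k\<in>S. \<Sum>l\<in>S. h k l * u l * cnj (u k))"
    if S: "finite S" for S
  proof -
    have "\<alpha> * (\<Sum>k\<in>S - {0}. (norm (u k))\<^sup>2) \<le>
        Re (\<Sum>k\<in>S - {0}. \<Sum>l\<in>S - {0}. h k l * u l * cnj (u k))"
      using S by (intro coercive_finite) auto
    moreover have "(\<Sum>k\<in>S - {0}. (norm (u k))\<^sup>2) = (\<Sum>k\<in>S. (norm (u k))\<^sup>2)"
      using S u(2) by (intro sum.mono_neutral_left) auto
    moreover have "(\<Sum>l\<in>S - {0}. h k l * u l * cnj (u k)) = (\<Sum>l\<in>S. h k l * u l * cnj (u k))" for k
      using S u(2) by (intro sum.mono_neutral_left) auto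
    moreover have "(\<Sum>k\<in>S - {0}. \<Sum>l\<in>S. h k l * u l * cnj (u k)) =
        (\<Sum>k\<in>S. \<Sum>l\<in>S. h k l * u l * cnj (u k))"
      using S u(2) by (intro sum.mono_neutral_left) auto
    ultimately show ?thesis by simp
  qed
  then show "eventually (\<lambda>S. \<alpha> * (\<Sum>k\<in>S. (norm (u k))\<^sup>2) \<le>
      Re (\<Sum>k\<in>S. \<Sum>l\<in>S. h k l * u l * cnj (u k))) (finite_subsets_at_top UNIV)"
    by (intro eventually_finite_subsets_at_top_weakI)
qed simp

lemma app_eq_0_imp:
  assumes u: "ell2 u" "u 0 = 0" and "\<And>k. app u k = 0"
  shows "u k = 0"
proof -
  have "ell2_inner (app u) u = 0" by (simp add: ell2_inner_def assms(3))
  then have "\<alpha> * (ell2_norm u)\<^sup>2 \<le> 0" using coercive[OF u] by simp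
  then have "ell2_norm u = 0"
    using \<alpha>_pos by (simp add: mult_le_0_iff)
  then show ?thesis using norm_le_ell2_norm[OF u(1), of k] by simp
qed

text \<open>Existence by the contraction \<open>v \<mapsto> v - \<rho> (app v - f)\<close>.\<close>

lemma app_surj:
  assumes f: "ell2 f" "f 0 = 0"
  obtains u where "ell2 u" "u 0 = 0" "\<And>k. app u k = f k"
proof -
  \<comment> \<open>L bounds the norm of T; the added \<alpha> makes it positive and at least
    \<alpha>, so the square root below is that of a nonnegative number. \<rho> minimises 1 - 2
    \<rho> \<alpha> + \<rho>^2 L^2, and q^2 is the minimum.\<close>
  define L where "L = infsum a UNIV + \<alpha>"
  define \<rho> where "\<rho> = \<alpha> / L\<^sup>2"
  define q where "q = sqrt (1 - \<alpha>\<^sup>2 / L\<^sup>2)"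
  have La: "0 \<le> infsum a UNIV" by (intro infsum_nonneg a_nonneg)
  then have L: "0 < L" "\<alpha> \<le> L" "infsum a UNIV \<le> L" using \<alpha>_pos by (auto simp: L_def)
  have "\<alpha>\<^sup>2 \<le> L\<^sup>2" using L \<alpha>_pos by (intro power_mono) auto
  then have q2: "q\<^sup>2 = 1 - \<alpha>\<^sup>2 / L\<^sup>2" "0 \<le> q"
    using L by (auto simp: q_def)
  have q1: "q < 1" 
    using \<alpha>_pos L by (auto simp: q_def)
  have \<rho>: "0 < \<rho>" using \<alpha>_pos L by (auto simp: \<rho>_def)
  define R where "R v = (\<lambda>k. v k - complex_of_real \<rho> * app v k)" for v
  have R: "ell2 (R v)" "R v 0 = 0" "ell2_norm (R v) \<le> q * ell2_norm v"
    if v: "ell2 v" "v 0 = 0" for v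
  proof -
    have e: "ell2 (\<lambda>k. complex_of_real \<rho> * app v k)"
      "ell2_norm (\<lambda>k. complex_of_real \<rho> * app v k) = \<rho> * ell2_norm (app v)"
      using ell2_cmult[OF app_bounded(1)[OF v(1)], of "complex_of_real \<rho>"] \<rho> by auto
    show "ell2 (R v)" "R v 0 = 0"
      unfolding R_def using ell2_diff(1)[OF v(1) e(1)] v(2) by (auto simp: app_at_zero)
    have "(ell2_norm (R v))\<^sup>2 = (ell2_norm v)\<^sup>2 - 2 * (\<rho> * Re (ell2_inner (app v) v)) +
        \<rho>\<^sup>2 * (ell2_norm (app v))\<^sup>2"
      unfolding R_def ell2_norm_diff_power2[OF v(1) e(1)]
      by (simp add: ell2_inner_cmult_left e(2) power_mult_distrib)
    also have "\<dots> \<le> (ell2_norm v)\<^sup>2 - 2 * (\<rho> * (\<alpha> * (ell2_norm v)\<^sup>2)) +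
        \<rho>\<^sup>2 * (L * ell2_norm v)\<^sup>2"
    proof -
      have "ell2_norm (app v) \<le> L * ell2_norm v"
        using app_bounded(2)[OF v(1)] mult_right_mono[OF L(3), of "ell2_norm v"] by simp
      then have "\<rho>\<^sup>2 * (ell2_norm (app v))\<^sup>2 \<le> \<rho>\<^sup>2 * (L * ell2_norm v)\<^sup>2"
        by (intro mult_left_mono power_mono) auto
      moreover have "\<rho> * (\<alpha> * (ell2_norm v)\<^sup>2) \<le> \<rho> * Re (ell2_inner (app v) v)"
        using coercive[OF v] \<rho> by (intro mult_left_mono) auto
      ultimately show ?thesis by linarith
    qed
    also have "\<dots> = (1 - \<alpha>\<^sup>2 / L\<^sup>2) * (ell2_norm v)\<^sup>2"
      using L by (simp add: \<rho>_def field_simps power2_eq_square)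
    also have "\<dots> = (q * ell2_norm v)\<^sup>2"
      by (simp add: q2 power_mult_distrib)
    finally show "ell2_norm (R v) \<le> q * ell2_norm v"
      by (rule power2_le_imp_le) (use q2 in auto)
  qed
  \<comment> \<open>A fixed point of \<open>G\<close> satisfies \<rho> (T v - f) = 0.\<close>
  define G where "G v = (\<lambda>k. R v k + complex_of_real \<rho> * f k)" for v
  define U where "U n = (G ^^ n) (\<lambda>_. 0)" for n :: nat
  define D where "D = ell2_norm (\<lambda>k. complex_of_real \<rho> * f k)"
  have \<rho>f: "ell2 (\<lambda>k. complex_of_real \<rho> * f k)" by (rule ell2_cmult[OF f(1)])
  have USuc: "U (Suc n) = G (U n)" and U0: "U 0 = (\<lambda>_. 0)" for n by (simp_all add: U_def)
  have U: "ell2 (U n)" "U n 0 = 0" for n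
    by (induction n) (auto simp: U0 USuc G_def R f(2) intro!: ell2_add R \<rho>f)
  have Gdiff: "G v k - G w k = R (\<lambda>k. v k - w k) k" if "ell2 v" "ell2 w" for v w k
    by (simp add: G_def R_def app_diff[OF that] algebra_simps)
  \<comment> \<open>\<open>G\<close> applied n times carries the pair \<open>U i\<close>,
    \<open>U 0\<close> to \<open>U (n + i)\<close>, \<open>U n\<close>, and \<open>U 0\<close> is
    zero.\<close>
  have contr: "ell2_norm (\<lambda>k. U (n + i) k - U n k) \<le> q ^ n * ell2_norm (U i)" for n i
  proof (induction n)
    case (Suc n)
    have "ell2_norm (\<lambda>k. U (Suc n + i) k - U (Suc n) k) \<le> q * ell2_norm (\<lambda>k. U (n + i) k - U n k)"
      using U by (simp add: USuc Gdiff) (intro R ell2_diff, auto)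
    also have "\<dots> \<le> q * (q ^ n * ell2_norm (U i))"
      using Suc q2 by (intro mult_left_mono) auto
    finally show ?case by simp
  qed (simp add: U0)
  have bdd: "ell2_norm (U i) \<le> D / (1 - q)" for i
  proof (induction i)
    case (Suc i)
    have "ell2_norm (U (Suc i)) \<le> ell2_norm (R (U i)) + D"
      unfolding USuc G_def D_def by (intro ell2_add R U \<rho>f)
    also have "\<dots> \<le> q * ell2_norm (U i) + D" by (intro add_right_mono R U)
    also have "\<dots> \<le> q * (D / (1 - q)) + D"
      using Suc q2 by (intro add_right_mono mult_left_mono) auto
    also have "\<dots> = D / (1 - q)" using q1 by (simp add: field_simps)
    finally show ?case .
  qed (use q1 in \<open>simp add: U0 D_def\<close>)
  define K where "K = D / (1 - q)"
  have diff: "ell2_norm (\<lambda>k. U (n + i) k - U n k) \<le> q ^ n * K" for n i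
    using contr[of n i] mult_left_mono[OF bdd[of i], of "q ^ n"] q2 by (simp add: K_def)
  have lim0: "(\<lambda>n. q ^ n * C) \<longlonglongrightarrow> 0" for C
    using tendsto_mult_right[OF LIMSEQ_power_zero[of q], of C] q1 q2 by (simp add: mult.commute)
  have "Cauchy (\<lambda>n. U n k)" for k
  proof (rule metric_CauchyI)
    fix e :: real
    assume "0 < e"
    then obtain M where M: "\<And>n. n \<ge> M \<Longrightarrow> \<bar>q ^ n * K\<bar> < e / 2"
      using LIMSEQ_D[OF lim0[of K], of "e / 2"] by auto
    have *: "dist (U n k) (U M k) < e / 2" if "n \<ge> M" for n
    proof -
      have "norm (U (M + (n - M)) k - U M k) \<le> ell2_norm (\<lambda>k. U (M + (n - M)) k - U M k)"
        using norm_le_ell2_norm[OF ell2_diff(1)[OF U(1) U(1)]] .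
      also have "\<dots> \<le> q ^ M * K" by (rule diff)
      also have "\<dots> < e / 2" using M[of M] by simp
      finally show ?thesis using that by (simp add: dist_norm)
    qed
    show "\<exists>M. \<forall>m\<ge>M. \<forall>n\<ge>M. dist (U m k) (U n k) < e"
      using * by (meson dist_triangle_half_l)
  qed
  then have "\<exists>x. (\<lambda>n. U n k) \<longlonglongrightarrow> x" for k
    using Cauchy_convergent convergent_def by blast
  then obtain u where u: "\<And>k. (\<lambda>n. U n k) \<longlonglongrightarrow> u k" by metis
  \<comment> \<open>For fixed n the bound on \<open>U (n + i) - U n\<close> survives the
    coordinatewise limit in i on every finite section; this yields both square summability and the
    rate of convergence.\<close>
  have un: "ell2 (\<lambda>k. u k - U n k)" "ell2_norm (\<lambda>k. u k - U n k) \<le> q ^ n * K" for n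
  proof -
    have "L2_set (\<lambda>k. norm (u k - U n k)) S \<le> q ^ n * K" for S
    proof -
      have "(\<lambda>i. L2_set (\<lambda>k. norm (U (n + i) k - U n k)) S) \<longlonglongrightarrow> L2_set (\<lambda>k. norm (u k - U n k)) S"
      proof -
        have "(\<lambda>i. U (n + i) k) \<longlonglongrightarrow> u k" for k
          using LIMSEQ_ignore_initial_segment[OF u[of k], of n] by (simp add: add.commute)
        then show ?thesis unfolding L2_set_def by (intro tendsto_intros)
      qed
      moreover have "L2_set (\<lambda>k. norm (U (n + i) k - U n k)) S \<le> q ^ n * K" for i
        using L2_set_le_ell2_norm[OF ell2_diff(1)[OF U(1) U(1)]] diff order_trans by blast
      ultimately show ?thesis by (intro LIMSEQ_le_const2) auto
    qed
    from ell2_bounded[of "\<lambda>k. u k - U n k", OF this]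
    show "ell2 (\<lambda>k. u k - U n k)" "ell2_norm (\<lambda>k. u k - U n k) \<le> q ^ n * K" by auto
  qed
  have ul: "ell2 u" using un(1)[of 0] by (simp add: U0)
  have uz: "u 0 = 0" using LIMSEQ_unique[OF u[of 0]] U(2) by auto
  have "norm (app u k - f k) \<le> q ^ n * (infsum a UNIV * K + 2 * K / \<rho>)" for n k
  proof -
    have "app u k - app (U n) k = app (\<lambda>k. u k - U n k) k"
      by (simp add: app_diff ul U)
    moreover have "norm (app (\<lambda>k. u k - U n k) k) \<le> infsum a UNIV * (q ^ n * K)"
      using norm_le_ell2_norm[OF app_bounded(1)[OF un(1)[of n]], of k] app_bounded(2)[OF un(1)[of n]]
        mult_left_mono[OF un(2)[of n] La] by linarith
    moreover have "norm (app (U n) k - f k) \<le> 2 * (q ^ n * K) / \<rho>"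
    proof -
      \<comment> \<open>The residual at \<open>U n\<close> is the increment
        \<open>U n - U (n + 1)\<close> divided by \<rho>; inserting the limit u bounds it by two
        tails.\<close>
      have "complex_of_real \<rho> * (app (U n) k - f k) = (u k - U (n + 1) k) - (u k - U n k)"
        by (simp add: USuc G_def R_def algebra_simps)
      then have "\<rho> * norm (app (U n) k - f k) = norm ((u k - U (n + 1) k) - (u k - U n k))"
        by (metis \<rho> norm_mult norm_of_real abs_of_pos)
      also have "\<dots> \<le> norm (u k - U (n + 1) k) + norm (u k - U n k)" by (rule norm_triangle_ineq4)
      also have "\<dots> \<le> q ^ (n + 1) * K + q ^ n * K"
        using norm_le_ell2_norm[OF un(1)] un(2) by (intro add_mono) (blast intro: order_trans)+
      also have "\<dots> \<le> q ^ n * K + q ^ n * K"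
      proof (intro add_right_mono mult_right_mono power_decreasing)
        show "0 \<le> K" using bdd[of 0] by (simp add: K_def U0)
      qed (use q1 q2 in auto)
      finally show ?thesis using \<rho> by (simp add: field_simps)
    qed
    ultimately have "norm (app u k - f k) \<le> infsum a UNIV * (q ^ n * K) + 2 * (q ^ n * K) / \<rho>"
      using norm_diff_triangle_le[of "app u k" "app (U n) k" _ "f k"] by simp
    then show ?thesis by (simp add: algebra_simps)
  qed
  then have "norm (app u k - f k) \<le> 0" for k
    by (intro LIMSEQ_le_const[OF lim0]) auto
  then have "app u k = f k" for k by simp
  with ul uz show ?thesis by (rule that)
qed

text \<open>The weights \<open>r\<^sup>s\<close> are replaced by the bounded weights \<open>\<tau>\<^sup>s\<close>, so that \<open>\<tau>\<^sup>s u\<close> is known to be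
  square summable before any regularity of \<open>u\<close> is.\<close>

lemma truncated_regularity:
  fixes r \<tau> :: "'k \<Rightarrow> real"
  assumes u: "ell2 u" "u 0 = 0"
    and \<tau>: "\<And>k. 0 \<le> \<tau> k" "\<And>k. \<tau> k \<le> r k" "\<And>k. \<tau> k \<le> R" "\<And>k l. \<bar>\<tau> k - \<tau> l\<bar> \<le> r (k - l)"
    and B: "\<And>j. j < s \<Longrightarrow> (\<lambda>q. a q * r q ^ (s - j)) summable_on UNIV"
      "\<And>j. j < s \<Longrightarrow> (\<Sum>\<^sub>\<infinity>q. a q * r q ^ (s - j)) \<le> B (s - j)"
    and lower: "\<And>j. j < s \<Longrightarrow> ell2 (\<lambda>k. r k ^ j * norm (u k))"
    and rhs: "ell2 (\<lambda>k. r k ^ s * norm (app u k))"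
  shows "\<alpha> * ell2_norm (\<lambda>k. complex_of_real (\<tau> k ^ s) * u k) \<le>
    ell2_norm (\<lambda>k. r k ^ s * norm (app u k)) +
    (\<Sum>j<s. real (s choose j) * B (s - j) * ell2_norm (\<lambda>k. r k ^ j * norm (u k)))"
proof -
  define w where "w = (\<lambda>k. complex_of_real (\<tau> k ^ s) * u k)"
  define v where "v = (\<lambda>k. complex_of_real (\<tau> k ^ s) * app u k)"
  define E where "E j = ell2_norm (\<lambda>k. r k ^ j * norm (u k))" for j
  define g where "g j k = (\<Sum>\<^sub>\<infinity>l. (a (k - l) * r (k - l) ^ (s - j)) * (r l ^ j * norm (u l)))" for j k
  have r: "0 \<le> r k" for k using \<tau>(1,2) order_trans by blast
  have R: "0 \<le> R" using \<tau>(1,3) order_trans by blast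
  have w: "ell2 w"
  proof (rule ell2_mono(1))
    show "ell2 (\<lambda>k. complex_of_real (R ^ s) * u k)" by (rule ell2_cmult[OF u(1)])
    show "norm (w k) \<le> norm (complex_of_real (R ^ s) * u k)" for k
      unfolding w_def norm_mult norm_of_real using \<tau>(1,3) R
      by (intro mult_right_mono) (auto simp: power_mono abs_mult power_abs)
  qed
  have w0: "w 0 = 0" by (simp add: w_def u)
  have v: "ell2 v" "ell2_norm v \<le> ell2_norm (\<lambda>k. r k ^ s * norm (app u k))"
  proof -
    have "norm (v k) \<le> norm (r k ^ s * norm (app u k))" for k
      unfolding v_def norm_mult norm_of_real using \<tau>(1,2) r
      by (simp add: norm_mult power_abs mult_right_mono power_mono)
    from ell2_mono[OF rhs this] show "ell2 v" "ell2_norm v \<le> ell2_norm (\<lambda>k. r k ^ s * norm (app u k))"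
      by auto
  qed
  have conv: "(\<lambda>l. (a (k - l) * r (k - l) ^ (s - j)) * (r l ^ j * norm (u l))) summable_on UNIV"
    "ell2 (g j)" "ell2_norm (g j) \<le> B (s - j) * E j" if "j < s" for j k
  proof -
    have 1: "0 \<le> a q * r q ^ (s - j)" for q using a_nonneg r by simp
    have 2: "0 \<le> r k ^ j * norm (u k)" for k using r by simp
    note c = ell2_convolution[OF B(1)[OF that] 1 lower[OF that] 2]
    show "(\<lambda>l. (a (k - l) * r (k - l) ^ (s - j)) * (r l ^ j * norm (u l))) summable_on UNIV"
      "ell2 (g j)"
      unfolding g_def using c by auto
    have "ell2_norm (g j) \<le> (\<Sum>\<^sub>\<infinity>q. a q * r q ^ (s - j)) * E j"
      unfolding g_def E_def using c by auto
    also have "\<dots> \<le> B (s - j) * E j"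
      unfolding E_def by (intro mult_right_mono B that) auto
    finally show "ell2_norm (g j) \<le> B (s - j) * E j" .
  qed
  \<comment> \<open>Entry (k, l) of the commutator is h k l times the difference of the weights at l
    and k. Its binomial bound splits into powers of r (k - l), joined to a, and powers of r l,
    joined to u: each j contributes one convolution \<open>g j\<close>.\<close>
  have comm: "norm (app w k - v k) \<le> (\<Sum>j<s. real (s choose j) * g j k)" for k
  proof -
    have "((\<lambda>l. h k l * w l + - (complex_of_real (\<tau> k ^ s) * (h k l * u l)))
        has_sum (app w k + - v k)) UNIV"
      unfolding v_def by (intro has_sum_add has_sum_uminusI has_sum_cmult_right app_has_sum w u)
    moreover have "((\<lambda>l. \<Sum>j<s. real (s choose j) *
        ((a (k - l) * r (k - l) ^ (s - j)) * (r l ^ j * norm (u l)))) has_sum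
        (\<Sum>j<s. real (s choose j) * g j k)) UNIV"
      unfolding g_def by (intro has_sum_sum has_sum_cmult_right has_sum_infsum conv) auto
    moreover have "norm (h k l * w l + - (complex_of_real (\<tau> k ^ s) * (h k l * u l))) \<le>
        (\<Sum>j<s. real (s choose j) * ((a (k - l) * r (k - l) ^ (s - j)) * (r l ^ j * norm (u l))))" for l
    proof -
      have "h k l * w l + - (complex_of_real (\<tau> k ^ s) * (h k l * u l)) =
          h k l * complex_of_real (\<tau> l ^ s - \<tau> k ^ s) * u l"
        by (simp add: w_def algebra_simps)
      then have "norm (h k l * w l + - (complex_of_real (\<tau> k ^ s) * (h k l * u l))) =
          norm (h k l) * \<bar>\<tau> k ^ s - \<tau> l ^ s\<bar> * norm (u l)"
        by (metis abs_minus_commute norm_mult norm_of_real)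
      also have "\<dots> \<le> a (k - l) * (\<Sum>j<s. real (s choose j) * \<tau> l ^ j * r (k - l) ^ (s - j)) * norm (u l)"
        by (intro mult_right_mono mult_mono h_le power_diff_le_binomial_sum \<tau> a_nonneg) auto
      also have "\<dots> \<le> a (k - l) * (\<Sum>j<s. real (s choose j) * r l ^ j * r (k - l) ^ (s - j)) * norm (u l)"
        by (intro mult_right_mono mult_left_mono sum_mono power_mono \<tau> a_nonneg) (auto simp: r)
      also have "\<dots> = (\<Sum>j<s. real (s choose j) * ((a (k - l) * r (k - l) ^ (s - j)) * (r l ^ j * norm (u l))))"
        by (simp add: sum_distrib_left sum_distrib_right mult_ac)
      finally show ?thesis .
    qed
    ultimately have "norm (app w k + - v k) \<le> (\<Sum>j<s. real (s choose j) * g j k)"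
      by (rule norm_infsum_le)
    then show ?thesis by simp
  qed
  have G: "ell2 (\<lambda>k. \<Sum>j<s. real (s choose j) * g j k)"
    "ell2_norm (\<lambda>k. \<Sum>j<s. real (s choose j) * g j k) \<le> (\<Sum>j<s. real (s choose j) * B (s - j) * E j)"
  proof -
    have c: "ell2 (\<lambda>k. real (s choose j) * g j k)"
      "ell2_norm (\<lambda>k. real (s choose j) * g j k) \<le> real (s choose j) * B (s - j) * E j"
      if "j < s" for j
      using ell2_cmult[OF conv(2)[OF that], of "real (s choose j)"]
        mult_left_mono[OF conv(3)[OF that], of "real (s choose j)"] by auto
    show "ell2 (\<lambda>k. \<Sum>j<s. real (s choose j) * g j k)"
      by (intro ell2_sum c) auto
    have "ell2_norm (\<lambda>k. \<Sum>j<s. real (s choose j) * g j k) \<le>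
        (\<Sum>j<s. ell2_norm (\<lambda>k. real (s choose j) * g j k))"
      by (intro ell2_sum c) auto
    also have "\<dots> \<le> (\<Sum>j<s. real (s choose j) * B (s - j) * E j)"
      by (intro sum_mono c) auto
    finally show "ell2_norm (\<lambda>k. \<Sum>j<s. real (s choose j) * g j k) \<le>
      (\<Sum>j<s. real (s choose j) * B (s - j) * E j)" .
  qed
  have "norm (app w k - v k) \<le> norm (\<Sum>j<s. real (s choose j) * g j k)" for k
    using comm[of k] by simp
  note cm = ell2_mono[OF G(1) this]
  \<comment> \<open>T w is split into the weighted T u and the commutator. Both are paired with w,
    so one factor \<open>ell2_norm w\<close> cancels at the end.\<close>
  have "\<alpha> * (ell2_norm w)\<^sup>2 \<le> Re (ell2_inner (app w) w)"
    by (rule coercive[OF w w0])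
  also have "\<dots> = Re (ell2_inner v w) + Re (ell2_inner (\<lambda>k. app w k - v k) w)"
    using ell2_inner_add_left[OF v(1) cm(1) w] by simp
  also have "\<dots> \<le> ell2_norm v * ell2_norm w + ell2_norm (\<lambda>k. app w k - v k) * ell2_norm w"
    using norm_ell2_inner_le[OF v(1) w] norm_ell2_inner_le[OF cm(1) w]
      complex_Re_le_cmod[of "ell2_inner v w"] complex_Re_le_cmod[of "ell2_inner (\<lambda>k. app w k - v k) w"]
    by linarith
  also have "\<dots> \<le> (ell2_norm (\<lambda>k. r k ^ s * norm (app u k)) +
      (\<Sum>j<s. real (s choose j) * B (s - j) * E j)) * ell2_norm w"
    unfolding distrib_right by (intro add_mono mult_right_mono v order_trans[OF cm(2) G(2)]) auto
  finally have le: "\<alpha> * (ell2_norm w)\<^sup>2 \<le> (ell2_norm (\<lambda>k. r k ^ s * norm (app u k)) +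
      (\<Sum>j<s. real (s choose j) * B (s - j) * E j)) * ell2_norm w" .
  show ?thesis
  proof (cases "ell2_norm w = 0")
    case True
    \<comment> \<open>No sign of \<open>B\<close> is assumed; the sum is nonnegative because it
      dominates a norm.\<close>
    have "0 \<le> (\<Sum>j<s. real (s choose j) * B (s - j) * E j)"
      using order_trans[OF ell2_norm_nonneg G(2)] .
    then show ?thesis using True unfolding E_def w_def[symmetric] by simp
  next
    case False
    then have "0 < ell2_norm w" using ell2_norm_nonneg[of w] by linarith
    with le show ?thesis unfolding E_def w_def[symmetric] by (simp add: power2_eq_square)
  qed
qed

text \<open>The bound in \<open>truncated_regularity\<close> does not involve R. For a finite
  section S take R as the sum of r over S: the truncated weight min (r k) R then equals r on S, and
  it inherits the Lipschitz bound from r. All sections are thus bounded by one constant.\<close>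

lemma regularity:
  fixes r :: "'k \<Rightarrow> real"
  assumes u: "ell2 u" "u 0 = 0"
    and r: "\<And>k. 0 \<le> r k" "\<And>k l. \<bar>r k - r l\<bar> \<le> r (k - l)"
    and B: "\<And>j. j < s \<Longrightarrow> (\<lambda>q. a q * r q ^ (s - j)) summable_on UNIV"
      "\<And>j. j < s \<Longrightarrow> (\<Sum>\<^sub>\<infinity>q. a q * r q ^ (s - j)) \<le> B (s - j)"
    and lower: "\<And>j. j < s \<Longrightarrow> ell2 (\<lambda>k. r k ^ j * norm (u k))"
    and rhs: "ell2 (\<lambda>k. r k ^ s * norm (app u k))"
  shows "ell2 (\<lambda>k. r k ^ s * norm (u k))"
    and "ell2_norm (\<lambda>k. r k ^ s * norm (u k)) \<le> inverse \<alpha> *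
      (ell2_norm (\<lambda>k. r k ^ s * norm (app u k)) +
      (\<Sum>j<s. real (s choose j) * B (s - j) * ell2_norm (\<lambda>k. r k ^ j * norm (u k))))"
proof -
  let ?C = "ell2_norm (\<lambda>k. r k ^ s * norm (app u k)) +
      (\<Sum>j<s. real (s choose j) * B (s - j) * ell2_norm (\<lambda>k. r k ^ j * norm (u k)))"
  have "L2_set (\<lambda>k. norm (r k ^ s * norm (u k))) S \<le> inverse \<alpha> * ?C" if "finite S" for S
  proof -
    define R where "R = (\<Sum>k\<in>S. r k)"
    define \<tau> where "\<tau> k = min (r k) R" for k
    have R: "0 \<le> R" unfolding R_def by (intro sum_nonneg r)
    have \<tau>S: "\<tau> k = r k" if "k \<in> S" for k
      using member_le_sum[of k S r] that \<open>finite S\<close> r by (simp add: \<tau>_def R_def)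
    have \<tau>: "0 \<le> \<tau> k" "\<tau> k \<le> r k" "\<tau> k \<le> R" "\<bar>\<tau> k - \<tau> l\<bar> \<le> r (k - l)" for k l
      using r(1)[of k] r(2)[of k l] R by (auto simp: \<tau>_def min_def)
    have "\<alpha> * ell2_norm (\<lambda>k. complex_of_real (\<tau> k ^ s) * u k) \<le> ?C"
      by (rule truncated_regularity[OF u \<tau>]) (use assms in auto)
    then have C: "ell2_norm (\<lambda>k. complex_of_real (\<tau> k ^ s) * u k) \<le> inverse \<alpha> * ?C"
      using \<alpha>_pos by (simp add: field_simps)
    have "ell2 (\<lambda>k. complex_of_real (\<tau> k ^ s) * u k)"
    proof (rule ell2_mono(1))
      show "ell2 (\<lambda>k. complex_of_real (R ^ s) * u k)" by (rule ell2_cmult[OF u(1)])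
      show "norm (complex_of_real (\<tau> k ^ s) * u k) \<le> norm (complex_of_real (R ^ s) * u k)" for k
        unfolding norm_mult norm_of_real using \<tau> R
        by (intro mult_right_mono) (auto simp: power_mono power_abs)
    qed
    note L2_set_le_ell2_norm[OF this, of S]
    moreover have "L2_set (\<lambda>k. norm (complex_of_real (\<tau> k ^ s) * u k)) S =
        L2_set (\<lambda>k. norm (r k ^ s * norm (u k))) S"
      by (rule L2_set_cong) (auto simp: \<tau>S norm_mult norm_power abs_mult power_abs)
    ultimately show ?thesis using C by linarith
  qed
  from ell2_bounded[of "\<lambda>k. r k ^ s * norm (u k)", OF this]
  show "ell2 (\<lambda>k. r k ^ s * norm (u k))" "ell2_norm (\<lambda>k. r k ^ s * norm (u k)) \<le> inverse \<alpha> * ?C"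
    by auto
qed

end


section \<open>The constants\<close>

text \<open>Pascal's rule with (x + y)^2 \<le> 2 x^2 + 2 y^2 costs a factor 4 per step, while the
  factorial gains n + 1 \<ge> 4. The constant c permits a start at small n, where the inequality
  without it fails.\<close>

lemma binomial_power2_le_fact_step:
  fixes c :: nat
  assumes "3 \<le> n\<^sub>0" "\<And>j. (n\<^sub>0 choose j)\<^sup>2 \<le> c * fact n\<^sub>0" "n\<^sub>0 \<le> n"
  shows "(n choose j)\<^sup>2 \<le> c * fact n"
  using assms(3)
proof (induction n arbitrary: j rule: dec_induct)
  case (step n)
  show ?case
  proof (cases j)
    case 0
    have "(1::nat) \<le> c * fact n" using step(3)[of 0] by simp
    also have "\<dots> \<le> c * fact (Suc n)" by (intro mult_left_mono fact_mono) auto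
    finally show ?thesis using 0 by simp
  next
    case (Suc i)
    define x y where "x = n choose i" and "y = n choose Suc i"
    have "int ((x + y)\<^sup>2) \<le> int (2 * x\<^sup>2 + 2 * y\<^sup>2)"
      using zero_le_power2[of "int x - int y"] by (simp add: power2_eq_square algebra_simps)
    then have "(x + y)\<^sup>2 \<le> 2 * x\<^sup>2 + 2 * y\<^sup>2" by (simp only: of_nat_le_iff)
    moreover have "2 * x\<^sup>2 + 2 * y\<^sup>2 \<le> 4 * (c * fact n)"
      using step(3)[of i] step(3)[of "Suc i"] by (simp add: x_def y_def)
    moreover have "4 * (c * fact n) \<le> Suc n * (c * fact n)"
      using step(1) assms(1) by (intro mult_right_mono) auto
    ultimately have "(x + y)\<^sup>2 \<le> Suc n * (c * fact n)" by linarith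
    moreover have "Suc n choose j = x + y" by (simp add: Suc x_def y_def)
    moreover have "Suc n * (c * fact n) = c * fact (Suc n)" by (simp add: algebra_simps)
    ultimately show ?thesis by metis
  qed
qed (rule assms(2))

lemma binomial_power2_le_4_fact:
  assumes "1 \<le> n"
  shows "(n choose j)\<^sup>2 \<le> 4 * fact n"
proof (cases "3 \<le> n")
  case True
  have "(3 choose i)\<^sup>2 \<le> 4 * fact 3" for i
    by (cases "i \<le> 3") (auto simp: le_Suc_eq numeral_eq_Suc)
  from binomial_power2_le_fact_step[OF _ this True] show ?thesis by simp
next
  case False
  then consider "n = 1" | "n = 2" using assms by linarith
  then show ?thesis
    by cases (cases "j \<le> 2"; auto simp: le_Suc_eq numeral_eq_Suc)+
qed

text \<open>The threshold 5 is sharp: for n = 4 and j = 2 the square is 36 > 24.\<close>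

lemma binomial_power2_le_fact:
  assumes "5 \<le> n"
  shows "(n choose j)\<^sup>2 \<le> fact n"
proof -
  have "(5 choose i)\<^sup>2 \<le> 1 * fact 5" for i
    by (cases "i \<le> 5") (auto simp: le_Suc_eq numeral_eq_Suc)
  from binomial_power2_le_fact_step[OF _ this assms] show ?thesis by simp
qed

text \<open>The coefficient counts monomials of degree j in d variables. Multiplied by d \<ge> 2 it
  is at least 4, the constant in \<open>binomial_power2_le_4_fact\<close>.\<close>

lemma binomial_multiindex_ge_2:
  assumes "1 \<le> j" "2 \<le> d"
  shows "2 \<le> (j + d - 1) choose (d - 1)"
proof -
  obtain e where e: "d = Suc (Suc e)" using assms(2) by (metis add_2_eq_Suc le_Suc_ex)
  have "0 < (j + e) choose e" "0 < (j + e) choose Suc e" using assms(1) by auto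
  then have "2 \<le> ((j + e) choose e) + ((j + e) choose Suc e)" by linarith
  then show ?thesis by (simp add: e)
qed

lemma power_le_1_plus_power:
  fixes r :: real
  assumes "0 \<le> r" "j \<le> s"
  shows "r ^ j \<le> 1 + r ^ s"
proof (cases "r \<le> 1")
  case True
  then show ?thesis using assms power_le_one[of r j] zero_le_power[of r s] by linarith
next
  case False
  then have "r ^ j \<le> r ^ s" using power_increasing[OF assms(2), of r] by simp
  then show ?thesis by simp
qed

text \<open>The Leibniz rule produces binomial coefficients that do not appear in \<open>M_const\<close>. They are
  absorbed by the factor \<open>sqrt ((m + 1)!) * sqrt d\<close> in \<open>C_const\<close>, except for \<open>d = 1\<close> and
  \<open>(m, j)\<close> one of \<open>(1, 1)\<close>, \<open>(2, 1)\<close>, \<open>(2, 2)\<close>, \<open>(3, 2)\<close>, where a sharper interpolation between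
  \<open>r\<^sup>0\<close> and \<open>r\<^bsup>m + 1\<^esup>\<close> compensates for the loss.\<close>

lemma interpolation_constants:
  fixes m j d :: nat
  assumes j: "1 \<le> j" "j \<le> m" and d: "1 \<le> d"
  defines "W \<equiv> sqrt (fact (m + 1)) * sqrt (real d) * sqrt (real ((j + d - 1) choose (d - 1)))"
  obtains a b :: real where "0 \<le> a" "0 \<le> b" "\<And>r. 0 \<le> r \<Longrightarrow> r ^ j \<le> a + b * r ^ (m + 1)"
    "real ((m + 1) choose j) * (1 + a) \<le> 2 * W" "real ((m + 1) choose j) * b \<le> W"
proof -
  note witness = that
  have largeI: "real ((m + 1) choose j) \<le> W"
    if "((m + 1) choose j)\<^sup>2 \<le> fact (m + 1) * (d * ((j + d - 1) choose (d - 1)))"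
  proof -
    have "(real ((m + 1) choose j))\<^sup>2 \<le> real (fact (m + 1) * (d * ((j + d - 1) choose (d - 1))))"
      using that by (metis of_nat_le_iff of_nat_power)
    then have "real ((m + 1) choose j) \<le> sqrt (real (fact (m + 1) * (d * ((j + d - 1) choose (d - 1)))))"
      by (rule real_le_rsqrt)
    also have "\<dots> = W" by (simp add: W_def real_sqrt_mult del: fact_Suc)
    finally show ?thesis .
  qed
  \<comment> \<open>With a = b = 1 both demands on the constants reduce to this one
    inequality.\<close>
  have large: thesis if "real ((m + 1) choose j) \<le> W"
    using that j power_le_1_plus_power[of _ j "m + 1"] by (intro witness[of 1 1]) auto
  show thesis
  proof (cases "2 \<le> d")
    case True
    have "((m + 1) choose j)\<^sup>2 \<le> fact (m + 1) * 4"
      using binomial_power2_le_4_fact[of "m + 1" j] by simp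
    also have "\<dots> \<le> fact (m + 1) * (d * ((j + d - 1) choose (d - 1)))"
      using mult_mono[OF True binomial_multiindex_ge_2[OF j(1) True]] by (intro mult_left_mono) auto
    finally show thesis by (intro large largeI)
  next
    case False
    then have d1: "d = 1" using d by simp
    show thesis
    proof (cases "4 \<le> m")
      case True
      then show thesis
        using binomial_power2_le_fact[of "m + 1" j] by (intro large largeI) (simp add: d1)
    next
      case False
      have W: "W = sqrt (fact (m + 1))" by (simp add: W_def d1)
      \<comment> \<open>Write C for (m + 1 choose j). In the first four cases C > W, so b = 1 is too
        large. Admissible are a \<le> 2 W / C - 1 and b \<le> W / C; the witnesses are these limits
        for rational lower bounds of W = sqrt 2, sqrt 6, sqrt 24, rounded down to two
        decimals.\<close>
      consider "m = 1 \<and> j = 1" | "m = 2 \<and> j = 1" | "m = 2 \<and> j = 2" | "m = 3 \<and> j = 2"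
        | "m = 3 \<and> (j = 1 \<or> j = 3)"
        using j False by linarith
      then show thesis
      proof cases
        case 1
        have "7 / 5 \<le> W" using 1 real_le_rsqrt[of "7 / 5" 2] by (simp add: W power2_eq_square)
        moreover have "r \<le> 2 / 5 + 7 / 10 * r\<^sup>2" for r :: real
          using zero_le_power2[of "r - 5 / 7"] by (simp add: power2_eq_square algebra_simps)
        ultimately show thesis
          using 1 by (intro witness[of "2 / 5" "7 / 10"]) (auto simp: power2_eq_square)
      next
        case 2
        have "61 / 25 \<le> W"
          using 2 real_le_rsqrt[of "61 / 25" 6] by (simp add: W power2_eq_square fact_numeral)
        moreover have "r \<le> 31 / 50 + 81 / 100 * r ^ 3" if "0 \<le> r" for r :: real
        proof -
          \<comment> \<open>The function a + b r^3 - r is smallest near r = 2/3. The double root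
            there gives r \<le> 4/9 + 3/4 r^3, and 4/9 < a, 3/4 < b.\<close>
          have "0 \<le> (r - 2 / 3)\<^sup>2 * (r + 4 / 3)" using that by simp
          also have "\<dots> = r ^ 3 - 4 / 3 * r + 16 / 27"
            by (simp add: power2_eq_square power3_eq_cube field_simps)
          finally show ?thesis using that by linarith
        qed
        ultimately show thesis
          using 2 by (intro witness[of "31 / 50" "81 / 100"]) (auto simp: numeral_eq_Suc)
      next
        case 3
        have "61 / 25 \<le> W"
          using 3 real_le_rsqrt[of "61 / 25" 6] by (simp add: W power2_eq_square fact_numeral)
        moreover have "r\<^sup>2 \<le> 31 / 50 + 81 / 100 * r ^ 3" if "0 \<le> r" for r :: real
        proof -
          have "r\<^sup>2 \<le> 1 / 3 + 2 / 3 * r ^ 3"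
            using mult_nonneg_nonneg[OF zero_le_power2[of "r - 1"], of "2 * r + 1"] that
            by (simp add: power2_eq_square power3_eq_cube algebra_simps)
          then show ?thesis using zero_le_power[OF that, of 3] by linarith
        qed
        ultimately show thesis
          using 3 by (intro witness[of "31 / 50" "81 / 100"]) (auto simp: numeral_eq_Suc)
      next
        case 4
        have "489 / 100 \<le> W"
          using 4 real_le_rsqrt[of "489 / 100" 24] by (simp add: W power2_eq_square fact_numeral)
        moreover have "r\<^sup>2 \<le> 63 / 100 + 81 / 100 * r ^ 4" for r :: real
          using zero_le_power2[of "r\<^sup>2 - 50 / 81"]
          by (simp add: power2_eq_square power4_eq_xxxx algebra_simps)
        ultimately show thesis
          using 4 by (intro witness[of "63 / 100" "81 / 100"]) (auto simp: numeral_eq_Suc)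
      next
        case 5
        then show thesis by (intro large largeI) (auto simp: d1 numeral_eq_Suc)
      qed
    qed
  qed
qed

lemma C_const_nonneg:
  assumes "0 < \<alpha>0" "\<And>b. 0 \<le> B b"
  shows "0 \<le> C_const \<alpha>0 d B m"
proof (induction m rule: less_induct)
  case (less m)
  have "0 \<le> M_const \<alpha>0 d B m"
  proof (cases "m = 0")
    case True
    then show ?thesis by (subst M_const.simps) simp
  next
    case False
    have "0 \<le> (\<Sum>j\<in>{1..m}. sqrt (real ((j + d - 1) choose (d - 1)))
        * B (m + 1 - j) * C_const \<alpha>0 d B (j - 1))"
      using less assms(2) by (intro sum_nonneg mult_nonneg_nonneg) auto
    then show ?thesis using False by (subst M_const.simps) (simp add: max_def)
  qed
  then show ?case
    using assms by (subst C_const.simps) (simp del: fact_Suc)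
qed

text \<open>Pure arithmetic: \<open>E s\<close> stands for the norm of r^s u and
  \<open>\<Phi> s\<close> for that of r^s f, so \<open>step\<close> is the regularity estimate and
  \<open>interpolate\<close> is \<open>ell2_interpolate\<close>. The term j = 0 gives the first
  summand of \<open>M_const\<close> through \<open>E 0\<close>; a term j \<ge> 1 brings the constant
  of index j - 1 times \<Phi> 0 + \<Phi> j. Interpolating \<Phi> j charges the sum over j twice to
  \<Phi> 0 and once to the top norm, whence the two entries of the maximum.\<close>

lemma a_priori_constant:
  fixes E \<Phi> B :: "nat \<Rightarrow> real"
  assumes \<alpha>0: "0 < \<alpha>0" and d: "1 \<le> d" and B: "\<And>b. 0 \<le> B b"
    and \<Phi>: "\<And>s. 0 \<le> \<Phi> s"
    and step: "\<And>s. s \<le> m + 1 \<Longrightarrow>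
      E s \<le> inverse \<alpha>0 * (\<Phi> s + (\<Sum>j<s. real (s choose j) * B (s - j) * E j))"
    and interpolate: "\<And>s j a b. \<lbrakk>s \<le> m + 1; 0 \<le> a; 0 \<le> b; \<And>r. 0 \<le> r \<Longrightarrow> r ^ j \<le> a + b * r ^ s\<rbrakk>
      \<Longrightarrow> \<Phi> j \<le> a * \<Phi> 0 + b * \<Phi> s"
  shows "E (m + 1) \<le> C_const \<alpha>0 d B m * (\<Phi> 0 + \<Phi> (m + 1))"
proof -
  have "E (l + 1) \<le> C_const \<alpha>0 d B l * (\<Phi> 0 + \<Phi> (l + 1))" if "l \<le> m" for l
    using that
  proof (induction l rule: less_induct)
    case (less l)
    define w where "w j = sqrt (real ((j + d - 1) choose (d - 1)))" for j
    define Q where "Q = sqrt (fact (l + 1)) * sqrt (real d)"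
    define X where "X j = B (l + 1 - j) * C_const \<alpha>0 d B (j - 1)" for j
    define S where "S = (\<Sum>j\<in>{1..l}. w j * X j)"
    have Q1: "1 \<le> Q"
      using mult_mono[of 1 "sqrt (fact (l + 1))" 1 "sqrt (real d)"] d fact_ge_1[of "l + 1"]
      unfolding Q_def by (simp del: fact_Suc)
    have X: "0 \<le> X j" for j
      unfolding X_def by (intro mult_nonneg_nonneg B C_const_nonneg \<alpha>0)
    have S: "0 \<le> S" unfolding S_def w_def by (intro sum_nonneg mult_nonneg_nonneg X) auto
    have M: "inverse \<alpha>0 * B (l + 1) + 2 * S \<le> M_const \<alpha>0 d B l" "1 + S \<le> M_const \<alpha>0 d B l"
      by (subst M_const.simps, simp add: S_def w_def X_def mult_ac)+
    have E0: "E 0 \<le> inverse \<alpha>0 * \<Phi> 0" using step[of 0] by simp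
    \<comment> \<open>The total weight 1 + a falls on \<Phi> 0 and b on \<Phi> (l + 1), which is the
      form of the two bounds in \<open>interpolation_constants\<close>.\<close>
    have summand: "real ((l + 1) choose j) * B (l + 1 - j) * E j \<le>
        2 * (Q * (w j * X j)) * \<Phi> 0 + Q * (w j * X j) * \<Phi> (l + 1)" if j: "j \<in> {1..l}" for j
    proof -
      have j': "1 \<le> j" "j \<le> l" using j by auto
      obtain a b :: real where ab: "0 \<le> a" "0 \<le> b" "\<And>r. 0 \<le> r \<Longrightarrow> r ^ j \<le> a + b * r ^ (l + 1)"
        "real ((l + 1) choose j) * (1 + a) \<le> 2 * (Q * w j)" "real ((l + 1) choose j) * b \<le> Q * w j"
        using interpolation_constants[OF j' d] unfolding Q_def w_def by blast
      have "E (j - 1 + 1) \<le> C_const \<alpha>0 d B (j - 1) * (\<Phi> 0 + \<Phi> (j - 1 + 1))"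
        by (rule less.IH) (use j' less.prems in auto)
      then have "E j \<le> C_const \<alpha>0 d B (j - 1) * (\<Phi> 0 + \<Phi> j)" using j' by simp
      also have "\<dots> \<le> C_const \<alpha>0 d B (j - 1) * (\<Phi> 0 + (a * \<Phi> 0 + b * \<Phi> (l + 1)))"
        using less.prems
        by (intro mult_left_mono add_left_mono interpolate ab C_const_nonneg \<alpha>0 B) auto
      finally have "real ((l + 1) choose j) * B (l + 1 - j) * E j \<le>
          real ((l + 1) choose j) * B (l + 1 - j) *
          (C_const \<alpha>0 d B (j - 1) * (\<Phi> 0 + (a * \<Phi> 0 + b * \<Phi> (l + 1))))"
        by (intro mult_left_mono mult_nonneg_nonneg B) auto
      also have "\<dots> = real ((l + 1) choose j) * (1 + a) * (X j * \<Phi> 0) +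
          real ((l + 1) choose j) * b * (X j * \<Phi> (l + 1))"
        by (simp add: X_def algebra_simps)
      also have "\<dots> \<le> 2 * (Q * w j) * (X j * \<Phi> 0) + Q * w j * (X j * \<Phi> (l + 1))"
        by (intro add_mono mult_right_mono ab mult_nonneg_nonneg X \<Phi>)
      finally show ?thesis by (simp add: mult_ac)
    qed
    have "(\<Sum>j<l + 1. real ((l + 1) choose j) * B (l + 1 - j) * E j) =
        B (l + 1) * E 0 + (\<Sum>j\<in>{1..l}. real ((l + 1) choose j) * B (l + 1 - j) * E j)"
      unfolding Suc_eq_plus1[symmetric] sum.lessThan_Suc_shift
      unfolding One_nat_def sum.atLeast1_atMost_eq by (simp del: binomial_Suc_Suc)
    also have "\<dots> \<le> B (l + 1) * (inverse \<alpha>0 * \<Phi> 0) +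
        (\<Sum>j\<in>{1..l}. 2 * (Q * (w j * X j)) * \<Phi> 0 + Q * (w j * X j) * \<Phi> (l + 1))"
      by (intro add_mono mult_left_mono sum_mono summand E0 B)
    also have "\<dots> = inverse \<alpha>0 * B (l + 1) * \<Phi> 0 + Q * (2 * S) * \<Phi> 0 + Q * S * \<Phi> (l + 1)"
      by (simp add: S_def sum.distrib sum_distrib_left sum_distrib_right mult_ac)
    finally have "\<Phi> (l + 1) + (\<Sum>j<l + 1. real ((l + 1) choose j) * B (l + 1 - j) * E j) \<le>
        1 * \<Phi> (l + 1) + 1 * (inverse \<alpha>0 * B (l + 1)) * \<Phi> 0 + Q * (2 * S) * \<Phi> 0 + Q * S * \<Phi> (l + 1)"
      by simp
    \<comment> \<open>Q \<ge> 1 is inserted in the two terms that do not carry it yet; the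
      coefficients of \<Phi> 0 and \<Phi> (l + 1) then become Q times the two entries of the
      maximum.\<close>
    also have "\<dots> \<le> Q * \<Phi> (l + 1) + Q * (inverse \<alpha>0 * B (l + 1)) * \<Phi> 0
        + Q * (2 * S) * \<Phi> 0 + Q * S * \<Phi> (l + 1)"
      using \<alpha>0 by (intro add_right_mono add_mono mult_right_mono Q1 mult_nonneg_nonneg \<Phi> B) auto
    also have "\<dots> = Q * ((inverse \<alpha>0 * B (l + 1) + 2 * S) * \<Phi> 0 + (1 + S) * \<Phi> (l + 1))"
      by (simp add: algebra_simps)
    also have "\<dots> \<le> Q * (M_const \<alpha>0 d B l * \<Phi> 0 + M_const \<alpha>0 d B l * \<Phi> (l + 1))"
      using Q1 by (intro mult_left_mono add_mono mult_right_mono M \<Phi>) auto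
    finally have "inverse \<alpha>0 * (\<Phi> (l + 1) + (\<Sum>j<l + 1. real ((l + 1) choose j) * B (l + 1 - j) * E j)) \<le>
        inverse \<alpha>0 * (Q * (M_const \<alpha>0 d B l * \<Phi> 0 + M_const \<alpha>0 d B l * \<Phi> (l + 1)))"
      using \<alpha>0 by (intro mult_left_mono) auto
    also have "\<dots> = C_const \<alpha>0 d B l * (\<Phi> 0 + \<Phi> (l + 1))"
      by (subst C_const.simps) (simp add: Q_def algebra_simps del: fact_Suc)
    finally show ?case
      using step[of "l + 1"] less.prems by simp
  qed
  then show ?thesis by simp
qed


section \<open>Lattice sums and the largest eigenvalue\<close>

lemma real_vec_0 [simp]: "real_vec 0 = 0"
  by (simp add: real_vec_def vec_eq_iff)

lemma real_vec_diff: "real_vec (k - l) = real_vec k - real_vec l"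
  by (simp add: real_vec_def vec_eq_iff)

lemma summable_on_int_powr:
  fixes t :: real
  assumes "1 < t"
  shows "(\<lambda>i::int. (1 + \<bar>real_of_int i\<bar>) powr (- t)) summable_on UNIV"
proof -
  have "summable (\<lambda>n. real (Suc n) powr (- t))"
    using assms summable_real_powr_iff[of "- t"] summable_Suc_iff[of "\<lambda>n. real n powr (- t)"] by simp
  then have nat: "(\<lambda>n. real (Suc n) powr (- t)) summable_on UNIV"
    by (simp add: summable_on_UNIV_nonneg_real_iff)
  have "(\<lambda>i::int. (1 + \<bar>real_of_int i\<bar>) powr (- t)) summable_on range int"
    using nat by (subst summable_on_reindex) (auto simp: inj_on_def o_def add.commute)
  moreover have "(\<lambda>i::int. (1 + \<bar>real_of_int i\<bar>) powr (- t)) summable_on range (\<lambda>n. - int n)"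
    using nat by (subst summable_on_reindex) (auto simp: inj_on_def o_def add.commute)
  moreover have "range int \<union> range (\<lambda>n. - int n) = UNIV"
    by (auto intro: int_cases2)
  ultimately show ?thesis
    using summable_on_union by metis
qed

text \<open>The exponent is shared equally among the n coordinates: with t = s / n > 1 the term is
  at most the product of the (1 + |k_i|)^(-t). A finite set of lattice points lies in a finite cube,
  over which the sum of products is a product of one-dimensional sums.\<close>

lemma summable_on_lattice_powr:
  fixes s :: real
  assumes "real CARD('n::finite) < s"
  shows "(\<lambda>k::int ^ 'n. (1 + norm (real_vec k)) powr (- s)) summable_on UNIV"
proof -
  define t where "t = s / real CARD('n)"
  define g where "g i = (1 + \<bar>real_of_int i\<bar>) powr (- t)" for i
  have t: "1 < t" using assms by (simp add: t_def)
  have g: "g summable_on UNIV" "\<And>i. 0 \<le> g i"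
    unfolding g_def using summable_on_int_powr[OF t] by auto
  have prod: "(1 + norm (real_vec k)) powr (- s) \<le> (\<Prod>i\<in>UNIV. g (k $ i))" for k :: "int ^ 'n"
  proof -
    have "0 < 1 + norm (real_vec k)" by (simp add: add_pos_nonneg)
    then have "(1 + norm (real_vec k)) powr (- s) = ((1 + norm (real_vec k)) powr (- t)) ^ CARD('n)"
      by (simp add: powr_power t_def)
    also have "\<dots> = (\<Prod>i\<in>(UNIV :: 'n set). (1 + norm (real_vec k)) powr (- t))"
      by simp
    also have "\<dots> \<le> (\<Prod>i\<in>UNIV. g (k $ i))"
    proof (intro prod_mono conjI)
      fix i
      have "\<bar>real_of_int (k $ i)\<bar> \<le> norm (real_vec k)"
        using component_le_norm_cart[of "real_vec k" i] by (simp add: real_vec_def)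
      then show "(1 + norm (real_vec k)) powr (- t) \<le> g (k $ i)"
        unfolding g_def using t by (intro powr_mono2') auto
    qed simp
    finally show ?thesis .
  qed
  have "(\<Sum>k\<in>S. (1 + norm (real_vec k)) powr (- s)) \<le> infsum g UNIV ^ CARD('n)"
    if S: "finite S" for S :: "(int ^ 'n) set"
  proof -
    define T where "T = (\<Union>k\<in>S. range (($) k))"
    have T: "finite T" unfolding T_def using S by auto
    have "(\<Sum>k\<in>S. (1 + norm (real_vec k)) powr (- s)) \<le> (\<Sum>k\<in>S. \<Prod>i\<in>UNIV. g (k $ i))"
      by (intro sum_mono prod)
    also have "\<dots> = (\<Sum>f\<in>($) ` S. \<Prod>i\<in>UNIV. g (f i))"
      by (subst sum.reindex) (auto simp: inj_on_def vec_eq_iff)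
    also have "\<dots> \<le> (\<Sum>f\<in>PiE (UNIV :: 'n set) (\<lambda>_. T). \<Prod>i\<in>UNIV. g (f i))"
    proof (rule sum_mono2)
      show "finite (PiE (UNIV :: 'n set) (\<lambda>_. T))" using T by (intro finite_PiE) auto
      show "($) ` S \<subseteq> PiE (UNIV :: 'n set) (\<lambda>_. T)" by (auto simp: T_def)
    qed (intro prod_nonneg g)
    also have "\<dots> = (\<Prod>i\<in>(UNIV :: 'n set). \<Sum>j\<in>T. g j)"
      using T by (subst prod_sum_PiE) auto
    also have "\<dots> = (\<Sum>j\<in>T. g j) ^ CARD('n)" by simp
    also have "\<dots> \<le> infsum g UNIV ^ CARD('n)"
      using T g by (intro power_mono finite_sum_le_infsum sum_nonneg) auto
    finally show ?thesis .
  qed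
  then show ?thesis
    by (intro nonneg_bdd_above_summable_on bdd_aboveI2[where M = "infsum g UNIV ^ CARD('n)"]) auto
qed

text \<open>\<open>lambda_max\<close> is a \<open>GREATEST\<close>, so a largest eigenvalue has to
  be exhibited. It is the maximum M of |P x|^2 over the compact unit sphere: a maximiser is an
  eigenvector for M, and every eigenvalue is a Rayleigh quotient, hence at most M.\<close>

lemma lambda_max_transpose_mult:
  fixes P :: "real ^ 'n ^ 'd"
  shows "0 \<le> lambda_max (transpose P ** P)"
    and "(norm (P *v x))\<^sup>2 \<le> lambda_max (transpose P ** P) * (norm x)\<^sup>2"
proof -
  let ?B = "transpose P ** P"
  have B: "(?B *v x) \<bullet> y = (P *v x) \<bullet> (P *v y)" for x y
  proof -
    have "?B *v x = (P *v x) v* P"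
      by (simp flip: matrix_vector_mul_assoc)
    then show ?thesis by (simp add: dot_lmul_matrix)
  qed
  have "compact (sphere (0::real ^ 'n) 1)" "sphere (0::real ^ 'n) 1 \<noteq> {}"
    by auto
  moreover have "continuous_on (sphere 0 1) (\<lambda>x. (norm (P *v x))\<^sup>2)"
    by (intro continuous_intros)
  ultimately obtain v where v: "norm v = 1"
    "\<And>x. norm x = 1 \<Longrightarrow> (norm (P *v x))\<^sup>2 \<le> (norm (P *v v))\<^sup>2"
    using continuous_attains_sup[of "sphere (0::real ^ 'n) 1" "\<lambda>x. (norm (P *v x))\<^sup>2"] by auto
  define M where "M = (norm (P *v v))\<^sup>2"
  have M: "(norm (P *v x))\<^sup>2 \<le> M * (norm x)\<^sup>2" for x
  proof (cases "x = 0")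
    case False
    have "(norm (P *v (x /\<^sub>R norm x)))\<^sup>2 \<le> M"
      unfolding M_def using False by (intro v) simp
    then show ?thesis
      using False by (simp add: matrix_vector_mult_scaleR power_mult_distrib field_simps)
  qed simp
  text \<open>The first variation of \<open>M |x|\<^sup>2 - |P x|\<^sup>2 \<ge> 0\<close> vanishes at the minimiser \<open>v\<close>.\<close>
  have "(?B *v v - M *\<^sub>R v) \<bullet> y = 0" for y
  proof (rule ccontr)
    define c where "c = (?B *v v - M *\<^sub>R v) \<bullet> y"
    define D where "D = M * (norm y)\<^sup>2 - (norm (P *v y))\<^sup>2"
    assume "(?B *v v - M *\<^sub>R v) \<bullet> y \<noteq> 0"
    then have c: "c \<noteq> 0" by (simp add: c_def)
    have D: "0 \<le> D" using M[of y] by (simp add: D_def)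
    have "2 * t * c \<le> t\<^sup>2 * D" for t
    proof -
      have expand: "(norm (x + t *\<^sub>R z))\<^sup>2 = (norm x)\<^sup>2 + 2 * t * (x \<bullet> z) + t\<^sup>2 * (norm z)\<^sup>2"
        for x z :: "real ^ 'k"
        unfolding power2_norm_eq_inner
        by (simp add: inner_simps inner_commute power2_eq_square algebra_simps)
      have "(norm (P *v (v + t *\<^sub>R y)))\<^sup>2 = M + 2 * t * ((P *v v) \<bullet> (P *v y)) + t\<^sup>2 * (norm (P *v y))\<^sup>2"
        by (simp add: M_def matrix_vector_right_distrib matrix_vector_mult_scaleR expand)
      moreover note expand[of v y]
      moreover have "2 * t * c = 2 * t * ((P *v v) \<bullet> (P *v y)) - M * (2 * t * (v \<bullet> y))"
        by (simp add: c_def inner_diff_left B algebra_simps)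
      ultimately show ?thesis
        using M[of "v + t *\<^sub>R y"] v(1) by (simp add: D_def distrib_left right_diff_distrib mult.left_commute[of M])
    qed
    note variation = this
    \<comment> \<open>At t = e the variation inequality reads 2 e^2 (D + 1) \<le> e^2 D; the added 1
      covers the case D = 0.\<close>
    define e where "e = c / (D + 1)"
    have e: "c = e * (D + 1)" "0 < e\<^sup>2" using D c by (auto simp: e_def)
    have "e\<^sup>2 * (2 * (D + 1)) \<le> e\<^sup>2 * D"
      using variation[of e] by (simp add: e(1) power2_eq_square mult_ac)
    then show False using e(2) D by simp
  qed
  then have "?B *v v - M *\<^sub>R v = 0"
    by (metis inner_eq_zero_iff)
  then have "is_eigenvalue ?B M"
    unfolding is_eigenvalue_def using v(1) by (intro exI[of _ v]) auto
  moreover have "l \<le> M" if ev: "is_eigenvalue ?B l" for l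
  proof -
    obtain x where x: "x \<noteq> 0" "?B *v x = l *\<^sub>R x"
      using ev unfolding is_eigenvalue_def by auto
    then have "l * (norm x)\<^sup>2 = (norm (P *v x))\<^sup>2"
      using B[of x x] by (simp add: power2_norm_eq_inner)
    then have "l * (norm x)\<^sup>2 \<le> M * (norm x)\<^sup>2" using M[of x] by simp
    then show ?thesis using x(1) by (simp add: mult_le_cancel_right)
  qed
  ultimately have "lambda_max ?B = M"
    unfolding lambda_max_def by (rule Greatest_equality)
  then show "0 \<le> lambda_max ?B" "(norm (P *v x))\<^sup>2 \<le> lambda_max ?B * (norm x)\<^sup>2"
    using M by (auto simp: M_def)
qed

lemma C_lambda_nonneg: "0 \<le> C_lambda P"
  unfolding C_lambda_def by (simp add: lambda_max_transpose_mult)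

lemma norm_mult_le_C_lambda: "norm (P *v x) \<le> C_lambda P * norm x"
proof (rule power2_le_imp_le)
  show "(norm (P *v x))\<^sup>2 \<le> (C_lambda P * norm x)\<^sup>2"
    unfolding C_lambda_def by (simp add: power_mult_distrib lambda_max_transpose_mult)
qed (simp add: C_lambda_nonneg)

lemma rat_independent_columns_nonzero:
  fixes P :: "real ^ 'n ^ 'd"
  assumes "rat_independent_columns P" "k \<noteq> 0"
  shows "P *v real_vec k \<noteq> 0"
proof
  assume "P *v real_vec k = 0"
  then have "(\<Sum>i\<in>UNIV. of_rat (of_int (k $ i)) *\<^sub>R column i P) = 0"
    by (simp add: matrix_mult_sum real_vec_def scalar_mult_eq_scaleR)
  then have "\<forall>i. (of_int (k $ i) :: rat) = 0"
    using assms(1) unfolding rat_independent_columns_def by (elim allE[of _ "\<lambda>i. of_int (k $ i)"] impE)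
  then show False using assms(2) by (simp add: vec_eq_iff)
qed

lemma C_lambda_A_nonneg: "0 \<le> C_A \<Longrightarrow> 0 \<le> C_lambda_A P C_A N b"
  unfolding C_lambda_A_def by (intro mult_nonneg_nonneg zero_le_power C_lambda_nonneg infsum_nonneg) auto

text \<open>\<open>C_lambda_A\<close> arises by replacing |P k| with \<open>C_lambda P\<close> times
  1 + |k| and the coefficient with its assumed decay. The lattice sum converges for N - b > n; b = 0
  gives summability of the coefficients, and b up to m + 1 serves the commutator.\<close>

lemma weighted_coeff_sum_le_C_lambda_A:
  fixes P :: "real ^ 'n ^ 'd" and c :: "int ^ 'n \<Rightarrow> real"
  assumes c: "\<And>k. 0 \<le> c k" "\<And>k. c k \<le> C_A * (1 + norm (real_vec k)) powr (- N)" and "0 \<le> C_A"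
    and N: "real CARD('n) + real b < N"
  shows "(\<lambda>k. c k * norm (P *v real_vec k) ^ b) summable_on UNIV"
    and "(\<Sum>\<^sub>\<infinity>k. c k * norm (P *v real_vec k) ^ b) \<le> C_lambda_A P C_A N b"
proof -
  define g where "g k = C_lambda P ^ b * C_A * (1 + norm (real_vec k)) powr (real b - N)" for k :: "int ^ 'n"
  have "(\<lambda>k::int ^ 'n. (1 + norm (real_vec k)) powr (- (N - real b))) summable_on UNIV"
    using N by (intro summable_on_lattice_powr) simp
  then have g: "g summable_on UNIV"
    unfolding g_def by (intro summable_on_cmult_right) simp
  have le: "c k * norm (P *v real_vec k) ^ b \<le> g k" for k
  proof -
    have "norm (P *v real_vec k) \<le> C_lambda P * (1 + norm (real_vec k))"
      using norm_mult_le_C_lambda[of P "real_vec k"] C_lambda_nonneg[of P] by (simp add: algebra_simps)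
    then have "c k * norm (P *v real_vec k) ^ b \<le>
        (C_A * (1 + norm (real_vec k)) powr (- N)) * (C_lambda P * (1 + norm (real_vec k))) ^ b"
      using assms(3) by (intro mult_mono c power_mono) auto
    also have "\<dots> = C_lambda P ^ b * C_A * ((1 + norm (real_vec k)) ^ b * (1 + norm (real_vec k)) powr (- N))"
      by (simp add: power_mult_distrib)
    also have "(1 + norm (real_vec k)) ^ b * (1 + norm (real_vec k)) powr (- N) =
        (1 + norm (real_vec k)) powr (real b - N)"
      by (subst powr_realpow[symmetric]) (auto simp: powr_add[symmetric] add_pos_nonneg)
    finally show ?thesis by (simp add: g_def)
  qed
  show s: "(\<lambda>k. c k * norm (P *v real_vec k) ^ b) summable_on UNIV"
    by (rule summable_on_comparison_test[OF g]) (auto simp: le c)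
  have "(\<Sum>\<^sub>\<infinity>k. c k * norm (P *v real_vec k) ^ b) \<le> infsum g UNIV"
    by (rule infsum_mono[OF s g]) (rule le)
  also have "\<dots> = C_lambda_A P C_A N b"
    unfolding g_def C_lambda_A_def by (rule infsum_cmult_right')
  finally show "(\<Sum>\<^sub>\<infinity>k. c k * norm (P *v real_vec k) ^ b) \<le> C_lambda_A P C_A N b" .
qed


section \<open>Trigonometric polynomials on the torus\<close>

lemma torus_cell_lebesgue [measurable]: "torus_cell \<in> sets lebesgue"
  by (simp add: torus_cell_def)

lemma continuous_on_torus_char [continuous_intros]: "continuous_on S (torus_char k)"
  unfolding torus_char_def by (intro continuous_intros)

lemma norm_torus_char [simp]: "norm (torus_char k y) = 1"
  by (simp add: torus_char_def)

lemma torus_char_mult_cnj: "torus_char l y * cnj (torus_char k y) = cnj (torus_char (k - l) y)"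
  by (simp add: torus_char_def exp_cnj real_vec_diff inner_diff_left algebra_simps flip: exp_add)

lemma integral_circle_char:
  fixes c :: int
  shows "(LINT t|lborel. indicator {0..2 * pi} t *\<^sub>R exp (\<i> * complex_of_real (real_of_int c * t))) =
    (if c = 0 then complex_of_real (2 * pi) else 0)"
proof (cases "c = 0")
  case True
  have "(LINT t|lborel. indicator {0..2 * pi} t *\<^sub>R (1::complex)) =
      complex_of_real (2 * pi) - complex_of_real 0"
    by (rule integral_FTC_Icc)
      (auto intro!: derivative_eq_intros simp: has_vector_derivative_of_real)
  then show ?thesis using True by simp
next
  case False
  define F where "F t = exp (\<i> * complex_of_real (real_of_int c * t)) / (\<i> * of_int c)" for t :: real
  have "(LINT t|lborel. indicator {0..2 * pi} t *\<^sub>R exp (\<i> * complex_of_real (real_of_int c * t))) =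
      F (2 * pi) - F 0"
  proof (rule integral_FTC_Icc)
    show "(F has_vector_derivative exp (\<i> * complex_of_real (real_of_int c * t)))
        (at t within {0..2 * pi})" for t
      unfolding F_def using False
      by (auto intro!: derivative_eq_intros has_vector_derivative_real_field simp: field_simps)
    show "continuous_on {0..2 * pi} (\<lambda>t. exp (\<i> * complex_of_real (real_of_int c * t)))"
      by (intro continuous_intros)
  qed simp
  also have "exp (\<i> * complex_of_real (real_of_int c * (2 * pi))) = 1"
    using exp_integer_2pi[of "real_of_int c"] by (simp add: mult_ac)
  then have "F (2 * pi) - F 0 = 0" by (simp add: F_def)
  finally show ?thesis using False by simp
qed

text \<open>Fubini: Lebesgue measure is the image of a product measure indexed by
  \<open>Basis\<close>, and both the indicator of the cell and the character factor over
  coordinates. A single nonzero component of k makes the product vanish.\<close>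

lemma integral_torus_char:
  "(LINT y|lebesgue_on torus_cell. torus_char k y) =
    (if k = (0 :: int ^ 'n) then (2 * pi) ^ CARD('n) else 0)"
proof -
  interpret product_sigma_finite "\<lambda>_ :: real ^ 'n. lborel :: real measure"
    by standard
  define \<phi> where "\<phi> b t = indicator {0..2 * pi} t *\<^sub>R exp (\<i> * complex_of_real ((real_vec k \<bullet> b) * t))"
    for b and t :: real
  have cont: "continuous_on UNIV (torus_char k)"
    by (intro continuous_intros)
  note [measurable] = borel_measurable_continuous_onI[OF cont]
  have cell [measurable]: "torus_cell \<in> sets (borel :: (real ^ 'n) measure)"
    by (simp add: torus_cell_def)
  have basis: "\<exists>i. b = axis i 1 \<and> real_vec k \<bullet> b = real_of_int (k $ i)" if "b \<in> Basis" for b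
    using that by (auto simp: Basis_vec_def inner_axis real_vec_def)
  have \<phi>: "(LINT t|lborel. \<phi> b t) = (if real_vec k \<bullet> b = 0 then complex_of_real (2 * pi) else 0)"
    if b: "b \<in> Basis" for b
  proof -
    obtain i where i: "real_vec k \<bullet> b = real_of_int (k $ i)"
      using basis[OF b] by blast
    show ?thesis
      unfolding \<phi>_def i integral_circle_char by simp
  qed
  have \<phi>_int: "integrable lborel (\<phi> b)" for b
    unfolding \<phi>_def by (intro borel_integrable_atLeastAtMost'[unfolded set_integrable_def] continuous_intros)
  have expand: "indicator torus_cell (\<Sum>b\<in>Basis. f b *\<^sub>R b) *\<^sub>R torus_char k (\<Sum>b\<in>Basis. f b *\<^sub>R b) =
      (\<Prod>b\<in>Basis. \<phi> b (f b))" for f :: "real ^ 'n \<Rightarrow> real"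
  proof -
    have "indicator torus_cell (\<Sum>b\<in>Basis. f b *\<^sub>R b) =
        (\<Prod>b\<in>(Basis :: (real ^ 'n) set). indicat_real {0..2 * pi} (f b))"
    proof -
      have "(\<Sum>b\<in>Basis. f b *\<^sub>R b) \<in> torus_cell \<longleftrightarrow> (\<forall>b\<in>Basis. f b \<in> {0..2 * pi})"
      proof -
        have "(\<chi> i. 2 * pi) \<bullet> b = 2 * pi" if "b \<in> Basis" for b :: "real ^ 'n"
          using that by (auto simp: Basis_vec_def inner_axis)
        then show ?thesis
          unfolding torus_cell_def mem_box
          by (intro ball_cong refl) (simp add: inner_sum_left_Basis)
      qed
      then show ?thesis
        by (auto simp: indicator_def prod_zero_iff)
    qed
    moreover have "torus_char k (\<Sum>b\<in>Basis. f b *\<^sub>R b) =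
        (\<Prod>b\<in>Basis. exp (\<i> * complex_of_real ((real_vec k \<bullet> b) * f b)))"
      unfolding torus_char_def
      by (simp add: inner_sum_right sum_distrib_left exp_sum mult.commute)
    ultimately show ?thesis
      by (simp add: \<phi>_def scaleR_conv_of_real prod.distrib del: of_real_mult)
  qed
  have "(LINT y|lebesgue_on torus_cell. torus_char k y) =
      (LINT y|lebesgue. indicator torus_cell y *\<^sub>R torus_char k y)"
    by (simp add: integral_restrict_space)
  also have "\<dots> = (LINT y|lborel. indicator torus_cell y *\<^sub>R torus_char k y)"
    by (rule integral_completion) measurable
  also have "\<dots> = (LINT f|Pi\<^sub>M Basis (\<lambda>_. lborel). indicator torus_cell (\<Sum>b\<in>Basis. f b *\<^sub>R b) *\<^sub>R
      torus_char k (\<Sum>b\<in>Basis. f b *\<^sub>R b))"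
    by (subst lborel_eq, rule integral_distr) measurable
  also have "\<dots> = (LINT f|Pi\<^sub>M (Basis :: (real ^ 'n) set) (\<lambda>_. lborel). (\<Prod>b\<in>Basis. \<phi> b (f b)))"
    by (simp only: expand)
  also have "\<dots> = (\<Prod>b\<in>Basis. LINT t|lborel. \<phi> b t)"
    by (rule product_integral_prod) (auto simp: \<phi>_int)
  also have "\<dots> = (\<Prod>b\<in>(Basis :: (real ^ 'n) set).
      if real_vec k \<bullet> b = 0 then complex_of_real (2 * pi) else 0)"
    by (intro prod.cong refl \<phi>)
  also have "\<dots> = (if k = 0 then (2 * pi) ^ CARD('n) else 0)"
  proof (cases "k = 0")
    case False
    then obtain i where "k $ i \<noteq> 0" by (auto simp: vec_eq_iff)
    then have "real_vec k \<bullet> axis i 1 \<noteq> 0" "axis i 1 \<in> (Basis :: (real ^ 'n) set)"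
      by (auto simp: inner_axis real_vec_def Basis_vec_def)
    then show ?thesis using False by (auto simp: prod_zero_iff)
  qed simp
  finally show ?thesis .
qed

lemma torus_mean_cnj_char: "torus_mean (\<lambda>y. cnj (torus_char k y)) = (if k = 0 then 1 else 0)"
  by (simp add: torus_mean_def integral_torus_char integral_cnj scaleR_conv_of_real field_simps)

lemma measurable_cnj [measurable]: "cnj \<in> borel_measurable borel"
  by (intro borel_measurable_continuous_onI continuous_intros)

lemma finite_measure_torus: "finite_measure (lebesgue_on (torus_cell :: (real ^ 'n) set))"
  by (rule finite_measureI) (simp add: emeasure_restrict_space torus_cell_def emeasure_lborel_cbox_eq)

lemma measurable_continuous_torus:
  "continuous_on UNIV f \<Longrightarrow> f \<in> borel_measurable (lebesgue_on torus_cell)"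
  by (rule continuous_imp_measurable_on_sets_lebesgue)
    (auto intro: continuous_on_subset)

lemma integrable_torus_bounded:
  fixes f :: "real ^ 'n \<Rightarrow> 'a::{banach, second_countable_topology}"
  assumes "f \<in> borel_measurable (lebesgue_on torus_cell)" "\<And>y. norm (f y) \<le> C"
  shows "integrable (lebesgue_on torus_cell) f"
  by (rule finite_measure.integrable_const_bound[OF finite_measure_torus, of _ C])
    (use assms in auto)

lemma torus_mean_mono:
  fixes f g :: "real ^ 'n \<Rightarrow> real"
  assumes "integrable (lebesgue_on torus_cell) f" "integrable (lebesgue_on torus_cell) g"
    "\<And>y. f y \<le> g y"
  shows "torus_mean f \<le> torus_mean g"
  unfolding torus_mean_def by (intro scaleR_left_mono integral_mono assms) auto

lemma torus_mean_nonneg: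
  fixes f :: "real ^ 'n \<Rightarrow> real"
  assumes "\<And>y. 0 \<le> f y"
  shows "0 \<le> torus_mean f"
  unfolding torus_mean_def using assms by (intro scaleR_nonneg_nonneg integral_nonneg_AE) auto

lemma torus_mean_sum:
  "(\<And>i. i \<in> I \<Longrightarrow> integrable (lebesgue_on torus_cell) (f i)) \<Longrightarrow>
    torus_mean (\<lambda>y. \<Sum>i\<in>I. f i y) = (\<Sum>i\<in>I. torus_mean (f i))"
  by (simp add: torus_mean_def scaleR_sum_right)

lemma torus_mean_cmult_right:
  fixes f :: "real ^ 'n \<Rightarrow> 'a::{real_normed_field, banach, second_countable_topology}"
  shows "torus_mean (\<lambda>y. f y * c) = torus_mean f * c"
  by (simp add: torus_mean_def)

definition trig :: "(int ^ 'n) set \<Rightarrow> (int ^ 'n \<Rightarrow> complex ^ 'd) \<Rightarrow> real ^ 'n \<Rightarrow> complex ^ 'd" where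
  "trig S c y = (\<Sum>k\<in>S. torus_char k y *s c k)"

lemma trig_nth: "trig S c y $ j = (\<Sum>k\<in>S. torus_char k y * c k $ j)"
  by (simp add: trig_def)

lemma continuous_on_trig: "continuous_on UNIV (trig S c)"
  unfolding trig_def vector_scalar_mult_def by (intro continuous_intros)

lemma measurable_trig [measurable]: "trig S c \<in> borel_measurable (lebesgue_on torus_cell)"
  by (intro measurable_continuous_torus continuous_on_trig)

lemma trig_bounded: "norm (trig S c y) \<le> (\<Sum>k\<in>S. norm (c k))"
proof -
  have "norm (torus_char k y *s c k) = norm (c k)" for k
    by (simp add: norm_vec_def L2_set_def norm_mult)
  then show ?thesis
    unfolding trig_def by (intro sum_norm_le) simp
qed

lemma norm_power2_vec: "(norm (x :: complex ^ 'd))\<^sup>2 = (\<Sum>j\<in>UNIV. (norm (x $ j))\<^sup>2)"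
  by (simp add: norm_vec_def L2_set_def sum_nonneg)

lemma norm_sum_mult_cnj_le: "norm (\<Sum>j\<in>UNIV. (x :: complex ^ 'd) $ j * cnj (y $ j)) \<le> norm x * norm y"
proof -
  have "norm (\<Sum>j\<in>UNIV. x $ j * cnj (y $ j)) \<le> (\<Sum>j\<in>UNIV. \<bar>norm (x $ j)\<bar> * \<bar>norm (y $ j)\<bar>)"
    by (rule order_trans[OF norm_sum]) (simp add: norm_mult)
  also have "\<dots> \<le> norm x * norm y"
    unfolding norm_vec_def by (rule L2_set_mult_ineq)
  finally show ?thesis .
qed

text \<open>The product of one character with the conjugate of another depends on k - l only, so
  this is a finite section of the Toeplitz matrix of A. The constant function 1 gives Parseval; a
  real A gives the matrix of the variational form.\<close>

lemma torus_mean_form: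
  fixes A :: "real ^ 'n \<Rightarrow> complex" and c c' :: "int ^ 'n \<Rightarrow> complex ^ 'd"
  assumes A [measurable]: "A \<in> borel_measurable (lebesgue_on torus_cell)" and bdd: "\<And>y. norm (A y) \<le> C"
    and S: "finite S"
  shows "torus_mean (\<lambda>y. \<Sum>j\<in>UNIV. A y * trig S c y $ j * cnj (trig S c' y $ j)) =
    (\<Sum>k\<in>S. \<Sum>l\<in>S. fourier_coeff A (k - l) * (\<Sum>j\<in>UNIV. c l $ j * cnj (c' k $ j)))"
proof -
  have [measurable]: "torus_char k \<in> borel_measurable (lebesgue_on torus_cell)" for k :: "int ^ 'n"
    by (intro measurable_continuous_torus continuous_intros)
  have int: "integrable (lebesgue_on torus_cell) (\<lambda>y. A y * cnj (torus_char k y) * x)" for k x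
    by (rule integrable_torus_bounded[where C = "C * norm x"])
      (auto simp: norm_mult intro!: mult_right_mono bdd)
  have "(\<Sum>j\<in>UNIV. A y * trig S c y $ j * cnj (trig S c' y $ j)) =
      (\<Sum>j\<in>UNIV. \<Sum>k\<in>S. \<Sum>l\<in>S. A y * cnj (torus_char (k - l) y) * (c l $ j * cnj (c' k $ j)))" for y
  proof (rule sum.cong[OF refl])
    fix j
    have "A y * trig S c y $ j * cnj (trig S c' y $ j) =
        (\<Sum>l\<in>S. \<Sum>k\<in>S. A y * (torus_char l y * c l $ j) * cnj (torus_char k y * c' k $ j))"
      by (simp add: trig_nth sum_distrib_left sum_distrib_right sum_product mult_ac)
    also have "\<dots> = (\<Sum>l\<in>S. \<Sum>k\<in>S. A y * cnj (torus_char (k - l) y) * (c l $ j * cnj (c' k $ j)))"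
      by (simp add: mult_ac flip: torus_char_mult_cnj)
    also have "\<dots> = (\<Sum>k\<in>S. \<Sum>l\<in>S. A y * cnj (torus_char (k - l) y) * (c l $ j * cnj (c' k $ j)))"
      by (rule sum.swap)
    finally show "A y * trig S c y $ j * cnj (trig S c' y $ j) =
        (\<Sum>k\<in>S. \<Sum>l\<in>S. A y * cnj (torus_char (k - l) y) * (c l $ j * cnj (c' k $ j)))" .
  qed
  then have "torus_mean (\<lambda>y. \<Sum>j\<in>UNIV. A y * trig S c y $ j * cnj (trig S c' y $ j)) =
      (\<Sum>j\<in>UNIV. \<Sum>k\<in>S. \<Sum>l\<in>S. fourier_coeff A (k - l) * (c l $ j * cnj (c' k $ j)))"
    by (simp only: torus_mean_sum int Bochner_Integration.integrable_sum torus_mean_cmult_right fourier_coeff_def)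
  also have "\<dots> = (\<Sum>k\<in>S. \<Sum>j\<in>UNIV. \<Sum>l\<in>S. fourier_coeff A (k - l) * (c l $ j * cnj (c' k $ j)))"
    by (rule sum.swap)
  also have "\<dots> = (\<Sum>k\<in>S. \<Sum>l\<in>S. \<Sum>j\<in>UNIV. fourier_coeff A (k - l) * (c l $ j * cnj (c' k $ j)))"
    by (intro sum.cong refl sum.swap)
  finally show ?thesis by (simp add: sum_distrib_left)
qed

lemma sum_mult_cnj_self: "(\<Sum>j\<in>UNIV. (x :: complex ^ 'd) $ j * cnj (x $ j)) = of_real ((norm x)\<^sup>2)"
  by (simp add: norm_power2_vec complex_norm_square[symmetric] del: of_real_power)

lemma torus_mean_of_real: "torus_mean (\<lambda>y. complex_of_real (f y)) = complex_of_real (torus_mean f)"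
  by (simp add: torus_mean_def scaleR_conv_of_real)

lemma torus_mean_trig_power2:
  assumes "finite S"
  shows "torus_mean (\<lambda>y. (norm (trig S c y))\<^sup>2) = (\<Sum>k\<in>S. (norm (c k))\<^sup>2)"
proof -
  have "complex_of_real (torus_mean (\<lambda>y. (norm (trig S c y))\<^sup>2)) =
      torus_mean (\<lambda>y. \<Sum>j\<in>UNIV. 1 * trig S c y $ j * cnj (trig S c y $ j))"
    by (simp add: sum_mult_cnj_self torus_mean_of_real[symmetric] del: of_real_power)
  also have "\<dots> = (\<Sum>k\<in>S. \<Sum>l\<in>S. fourier_coeff (\<lambda>_. 1) (k - l) * (\<Sum>j\<in>UNIV. c l $ j * cnj (c k $ j)))"
    by (rule torus_mean_form[where C = 1]) (use assms in auto)
  also have "\<dots> = (\<Sum>k\<in>S. \<Sum>l\<in>S. if k = l then of_real ((norm (c k))\<^sup>2) else 0)"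
    by (intro sum.cong refl) (auto simp: fourier_coeff_def torus_mean_cnj_char sum_mult_cnj_self
        simp del: of_real_power)
  also have "\<dots> = complex_of_real (\<Sum>k\<in>S. (norm (c k))\<^sup>2)"
    using assms by (simp del: of_real_power)
  finally show ?thesis by (simp only: of_real_eq_iff)
qed

text \<open>The double sum is the mean of A |g|^2 for g = \<open>trig S c\<close>, so the pointwise
  lower bound on A and Parseval give the claim.\<close>

lemma coercive_trig:
  fixes A :: "real ^ 'n \<Rightarrow> real"
  assumes A [measurable]: "A \<in> borel_measurable (lebesgue_on torus_cell)"
    and bdd: "\<And>y. \<alpha>0 \<le> A y" "\<And>y. A y \<le> \<alpha>1" and S: "finite S"
  shows "\<alpha>0 * (\<Sum>k\<in>S. (norm (c k))\<^sup>2) \<le> Re (\<Sum>k\<in>S. \<Sum>l\<in>S.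
    fourier_coeff (\<lambda>y. complex_of_real (A y)) (k - l) * (\<Sum>j\<in>UNIV. c l $ j * cnj (c k $ j)))"
proof -
  define C where "C = \<bar>\<alpha>0\<bar> + \<bar>\<alpha>1\<bar>"
  have C: "\<bar>A y\<bar> \<le> C" for y using bdd[of y] by (auto simp: C_def)
  define K where "K = (\<Sum>k\<in>S. norm (c k))"
  have sq: "(norm (trig S c y))\<^sup>2 \<le> K\<^sup>2" for y
    unfolding K_def by (intro power_mono trig_bounded) auto
  have int: "integrable (lebesgue_on torus_cell) (\<lambda>y. A y * (norm (trig S c y))\<^sup>2)"
    by (rule integrable_torus_bounded[where C = "C * K\<^sup>2"])
      (auto simp: abs_mult intro!: mult_mono C sq order_trans[OF abs_ge_zero C])
  have int': "integrable (lebesgue_on torus_cell) (\<lambda>y. (norm (trig S c y))\<^sup>2 * \<alpha>0)"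
    by (rule integrable_torus_bounded[where C = "K\<^sup>2 * \<bar>\<alpha>0\<bar>"])
      (auto simp: abs_mult intro!: mult_right_mono sq)
  have "complex_of_real (torus_mean (\<lambda>y. A y * (norm (trig S c y))\<^sup>2)) =
      torus_mean (\<lambda>y. \<Sum>j\<in>UNIV. complex_of_real (A y) * trig S c y $ j * cnj (trig S c y $ j))"
    by (simp add: mult.assoc sum_distrib_left[symmetric] sum_mult_cnj_self
        torus_mean_of_real[symmetric] del: of_real_power)
  also have "\<dots> = (\<Sum>k\<in>S. \<Sum>l\<in>S.
    fourier_coeff (\<lambda>y. complex_of_real (A y)) (k - l) * (\<Sum>j\<in>UNIV. c l $ j * cnj (c k $ j)))"
    by (rule torus_mean_form[where C = C]) (use C S in auto)
  finally have "Re (\<Sum>k\<in>S. \<Sum>l\<in>S.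
    fourier_coeff (\<lambda>y. complex_of_real (A y)) (k - l) * (\<Sum>j\<in>UNIV. c l $ j * cnj (c k $ j))) =
      torus_mean (\<lambda>y. A y * (norm (trig S c y))\<^sup>2)"
    by (metis Re_complex_of_real)
  moreover have "torus_mean (\<lambda>y. (norm (trig S c y))\<^sup>2 * \<alpha>0) \<le> torus_mean (\<lambda>y. A y * (norm (trig S c y))\<^sup>2)"
    by (rule torus_mean_mono[OF int' int]) (simp add: bdd mult.commute mult_right_mono)
  ultimately show ?thesis
    unfolding torus_mean_cmult_right torus_mean_trig_power2[OF S] by (simp only: mult.commute)
qed


section \<open>The Riesz--Fischer theorem on the torus\<close>

lemma integral_Cauchy_Schwarz:
  fixes f g :: "'a \<Rightarrow> real"
  assumes [measurable]: "f \<in> borel_measurable M" "g \<in> borel_measurable M"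
    and f: "integrable M (\<lambda>x. (f x)\<^sup>2)" and g: "integrable M (\<lambda>x. (g x)\<^sup>2)"
  shows "integrable M (\<lambda>x. f x * g x)"
    and "(\<integral>x. f x * g x \<partial>M) \<le> sqrt (\<integral>x. (f x)\<^sup>2 \<partial>M) * sqrt (\<integral>x. (g x)\<^sup>2 \<partial>M)"
proof -
  show fg: "integrable M (\<lambda>x. f x * g x)"
  proof (rule Bochner_Integration.integrable_bound[OF Bochner_Integration.integrable_add[OF f g]])
    have "\<bar>f x * g x\<bar> \<le> (f x)\<^sup>2 + (g x)\<^sup>2" for x
      using sum_squares_bound[of "\<bar>f x\<bar>" "\<bar>g x\<bar>"] abs_ge_zero[of "f x * g x"]
      unfolding abs_mult power2_abs by linarith
    then show "AE x in M. norm (f x * g x) \<le> norm ((f x)\<^sup>2 + (g x)\<^sup>2)"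
      by simp
  qed measurable
  define X F G where "X = (\<integral>x. f x * g x \<partial>M)" and "F = (\<integral>x. (f x)\<^sup>2 \<partial>M)"
    and "G = (\<integral>x. (g x)\<^sup>2 \<partial>M)"
  have FG: "0 \<le> F" "0 \<le> G" unfolding F_def G_def by (auto intro!: integral_nonneg_AE)
  have quad: "2 * t * X \<le> F + t\<^sup>2 * G" for t
  proof -
    have "0 \<le> (\<integral>x. (f x - t * g x)\<^sup>2 \<partial>M)" by (auto intro!: integral_nonneg_AE)
    also have "\<dots> = (\<integral>x. (f x)\<^sup>2 - 2 * t * (f x * g x) + t\<^sup>2 * (g x)\<^sup>2 \<partial>M)"
      by (simp add: power2_eq_square algebra_simps)
    also have "\<dots> = F - 2 * t * X + t\<^sup>2 * G"
      using f g fg by (simp add: F_def X_def G_def)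
    finally show ?thesis by simp
  qed
  have "X\<^sup>2 \<le> F * G"
  proof (cases "G = 0")
    case True
    have "X = 0"
    proof (rule ccontr)
      assume "X \<noteq> 0"
      \<comment> \<open>For G = 0 this choice of t yields F + 1 \<le> F.\<close>
      with quad[of "(F + 1) / (2 * X)"] show False by (simp add: True)
    qed
    then show ?thesis using FG by simp
  next
    case False
    then have "0 < G" using FG by simp
    with quad[of "X / G"] show ?thesis by (simp add: field_simps power2_eq_square)
  qed
  then have "X \<le> sqrt (F * G)" by (rule real_le_rsqrt)
  then show "(\<integral>x. f x * g x \<partial>M) \<le> sqrt (\<integral>x. (f x)\<^sup>2 \<partial>M) * sqrt (\<integral>x. (g x)\<^sup>2 \<partial>M)"
    by (simp add: X_def F_def G_def real_sqrt_mult)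
qed

definition torus_norm :: "(real ^ 'n \<Rightarrow> complex ^ 'd) \<Rightarrow> real" where
  "torus_norm g = sqrt (torus_mean (\<lambda>y. (norm (g y))\<^sup>2))"

lemma torus_norm_nonneg [simp]: "0 \<le> torus_norm g"
  unfolding torus_norm_def by (intro real_sqrt_ge_zero torus_mean_nonneg) auto

lemma torus_mean_Cauchy_Schwarz:
  assumes g: "g \<in> torus_L2" and h: "h \<in> torus_L2"
  shows "integrable (lebesgue_on torus_cell) (\<lambda>y. norm (g y) * norm (h y))"
    and "torus_mean (\<lambda>y. norm (g y) * norm (h y)) \<le> torus_norm g * torus_norm h"
proof -
  have [measurable]: "g \<in> borel_measurable (lebesgue_on torus_cell)"
    "h \<in> borel_measurable (lebesgue_on torus_cell)"
    using g h by (auto simp: torus_L2_def)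
  have int: "integrable (lebesgue_on torus_cell) (\<lambda>y. (norm (g y))\<^sup>2)"
    "integrable (lebesgue_on torus_cell) (\<lambda>y. (norm (h y))\<^sup>2)"
    using g h by (auto simp: torus_L2_def)
  have "(\<lambda>y. norm (g y)) \<in> borel_measurable (lebesgue_on torus_cell)"
    "(\<lambda>y. norm (h y)) \<in> borel_measurable (lebesgue_on torus_cell)"
    by measurable
  note cs = integral_Cauchy_Schwarz[OF this int]
  show "integrable (lebesgue_on torus_cell) (\<lambda>y. norm (g y) * norm (h y))" by (rule cs)
  have "torus_mean (\<lambda>y. norm (g y) * norm (h y)) \<le>
      (sqrt (LINT y|lebesgue_on torus_cell. (norm (g y))\<^sup>2) *
       sqrt (LINT y|lebesgue_on torus_cell. (norm (h y))\<^sup>2)) /\<^sub>R (2 * pi) ^ CARD('a)"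
    unfolding torus_mean_def by (intro scaleR_left_mono cs) auto
  also have "\<dots> = torus_norm g * torus_norm h"
  proof -
    have *: "inverse W * (a * b) = sqrt (inverse W) * a * (sqrt (inverse W) * b)" if "0 \<le> W" for a b W :: real
      using that real_sqrt_pow2[of "inverse W"] by (simp add: power2_eq_square mult_ac)
    show ?thesis
      unfolding torus_norm_def torus_mean_def real_scaleR_def real_sqrt_mult by (rule *) simp
  qed
  finally show "torus_mean (\<lambda>y. norm (g y) * norm (h y)) \<le> torus_norm g * torus_norm h" .
qed

lemma measurable_vec_nth [measurable (raw)]:
  assumes "g \<in> borel_measurable M"
  shows "(\<lambda>y. (g y :: complex ^ 'd) $ j) \<in> borel_measurable M"
  by (rule measurable_compose[OF assms]) (intro borel_measurable_continuous_onI continuous_intros)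

lemma torus_L2_diff:
  assumes g: "g \<in> torus_L2" and h: "h \<in> torus_L2"
  shows "(\<lambda>y. g y - h y) \<in> torus_L2"
proof -
  have [measurable]: "g \<in> borel_measurable (lebesgue_on torus_cell)"
    "h \<in> borel_measurable (lebesgue_on torus_cell)"
    using g h by (auto simp: torus_L2_def)
  have "integrable (lebesgue_on torus_cell) (\<lambda>y. (norm (g y - h y))\<^sup>2)"
  proof (rule Bochner_Integration.integrable_bound)
    show "integrable (lebesgue_on torus_cell) (\<lambda>y. 2 * (norm (g y))\<^sup>2 + 2 * (norm (h y))\<^sup>2)"
      using g h by (auto simp: torus_L2_def)
    have "(norm (g y - h y))\<^sup>2 \<le> 2 * (norm (g y))\<^sup>2 + 2 * (norm (h y))\<^sup>2" for y
    proof -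
      have "(norm (g y - h y))\<^sup>2 \<le> (norm (g y) + norm (h y))\<^sup>2"
        by (intro power_mono norm_triangle_ineq4) auto
      also have "\<dots> \<le> 2 * (norm (g y))\<^sup>2 + 2 * (norm (h y))\<^sup>2"
        using sum_squares_bound[of "norm (g y)" "norm (h y)"] by (simp add: power2_sum)
      finally show ?thesis .
    qed
    then show "AE y in lebesgue_on torus_cell. norm ((norm (g y - h y))\<^sup>2) \<le>
        norm (2 * (norm (g y))\<^sup>2 + 2 * (norm (h y))\<^sup>2)"
      by (auto intro!: AE_I2 simp: abs_of_nonneg)
  qed measurable
  then show ?thesis by (simp add: torus_L2_def)
qed

lemma trig_in_torus_L2: "trig S c \<in> torus_L2"
  unfolding torus_L2_def
  by (auto intro!: integrable_torus_bounded[where C = "(\<Sum>k\<in>S. norm (c k))\<^sup>2"] power_mono trig_bounded)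

lemma L2_inner_weighted:
  fixes A :: "real ^ 'n \<Rightarrow> real" and g h :: "real ^ 'n \<Rightarrow> complex ^ 'd"
  assumes A [measurable]: "A \<in> borel_measurable (lebesgue_on torus_cell)" and C: "\<And>y. \<bar>A y\<bar> \<le> C"
    and g: "g \<in> torus_L2" and h: "h \<in> torus_L2"
  shows "integrable (lebesgue_on torus_cell)
      (\<lambda>y. \<Sum>j\<in>UNIV. (complex_of_real (A y) *s g y) $ j * cnj (h y $ j))"
    and "norm (L2_inner (\<lambda>y. complex_of_real (A y) *s g y) h) \<le> C * (torus_norm g * torus_norm h)"
proof -
  have [measurable]: "g \<in> borel_measurable (lebesgue_on torus_cell)"
    "h \<in> borel_measurable (lebesgue_on torus_cell)"
    using g h by (auto simp: torus_L2_def)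
  have C0: "0 \<le> C" using C abs_ge_zero order_trans by blast
  define f where "f y = (\<Sum>j\<in>UNIV. (complex_of_real (A y) *s g y) $ j * cnj (h y $ j))" for y
  note cs = torus_mean_Cauchy_Schwarz[OF g h]
  have f: "norm (f y) \<le> C * (norm (g y) * norm (h y))" for y
  proof -
    have "norm (f y) \<le> norm (complex_of_real (A y) *s g y) * norm (h y)"
      unfolding f_def by (rule norm_sum_mult_cnj_le)
    also have "norm (complex_of_real (A y) *s g y) = \<bar>A y\<bar> * norm (g y)"
      by (simp add: norm_vec_def norm_mult L2_set_right_distrib)
    also have "\<bar>A y\<bar> * norm (g y) * norm (h y) \<le> C * norm (g y) * norm (h y)"
      by (intro mult_right_mono C) auto
    finally show ?thesis by (simp add: mult.assoc)
  qed
  have int: "integrable (lebesgue_on torus_cell) (\<lambda>y. C * (norm (g y) * norm (h y)))"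
    using cs(1) by simp
  have fint: "integrable (lebesgue_on torus_cell) f"
  proof (rule Bochner_Integration.integrable_bound[OF int])
    have "f = (\<lambda>y. \<Sum>j\<in>UNIV. complex_of_real (A y) * g y $ j * cnj (h y $ j))"
      by (simp add: f_def fun_eq_iff)
    also have "\<dots> \<in> borel_measurable (lebesgue_on torus_cell)" by measurable
    finally show "f \<in> borel_measurable (lebesgue_on torus_cell)" .
    show "AE y in lebesgue_on torus_cell. norm (f y) \<le> norm (C * (norm (g y) * norm (h y)))"
      using f C0 by (simp add: abs_of_nonneg)
  qed
  then show "integrable (lebesgue_on torus_cell)
      (\<lambda>y. \<Sum>j\<in>UNIV. (complex_of_real (A y) *s g y) $ j * cnj (h y $ j))"
    by (simp add: f_def[abs_def])
  have "norm (LINT y|lebesgue_on torus_cell. f y) \<le>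
      (LINT y|lebesgue_on torus_cell. C * (norm (g y) * norm (h y)))"
    by (rule Bochner_Integration.integral_norm_bound_integral[OF fint int]) (rule f)
  then have "norm (torus_mean f) \<le> torus_mean (\<lambda>y. C * (norm (g y) * norm (h y)))"
    unfolding torus_mean_def by (simp add: mult_left_mono)
  also have "\<dots> = C * torus_mean (\<lambda>y. norm (g y) * norm (h y))"
    by (simp add: torus_mean_def)
  also have "\<dots> \<le> C * (torus_norm g * torus_norm h)"
    by (intro mult_left_mono cs C0)
  finally show "norm (L2_inner (\<lambda>y. complex_of_real (A y) *s g y) h) \<le> C * (torus_norm g * torus_norm h)"
    by (simp add: L2_inner_def f_def[abs_def])
qed

text \<open>Only convergence in the L2 norm enters, so the limit is the same for every
  representative that \<open>P_grad\<close> may select.\<close>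

lemma L2_inner_tendsto:
  fixes A :: "real ^ 'n \<Rightarrow> real" and g h :: "real ^ 'n \<Rightarrow> complex ^ 'd"
  assumes A: "A \<in> borel_measurable (lebesgue_on torus_cell)" "\<And>y. \<bar>A y\<bar> \<le> C"
    and g: "g \<in> torus_L2" "\<And>i. gs i \<in> torus_L2" "((\<lambda>i. torus_norm (\<lambda>y. g y - gs i y)) \<longlongrightarrow> 0) \<F>"
    and h: "h \<in> torus_L2" "\<And>i. hs i \<in> torus_L2" "((\<lambda>i. torus_norm (\<lambda>y. h y - hs i y)) \<longlongrightarrow> 0) \<F>"
  shows "((\<lambda>i. L2_inner (\<lambda>y. complex_of_real (A y) *s gs i y) (hs i)) \<longlongrightarrow>
    L2_inner (\<lambda>y. complex_of_real (A y) *s g y) h) \<F>"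
proof -
  define B where "B g h = L2_inner (\<lambda>y. complex_of_real (A y) *s g y) h"
    for g h :: "real ^ 'n \<Rightarrow> complex ^ 'd"
  note w = L2_inner_weighted[OF A]
  have diff_left: "B (\<lambda>y. g y - g' y) h = B g h - B g' h"
    if "g \<in> torus_L2" "g' \<in> torus_L2" "h \<in> torus_L2" for g g' h
  proof -
    have "(\<lambda>y. \<Sum>j\<in>UNIV. (complex_of_real (A y) *s (g y - g' y)) $ j * cnj (h y $ j)) =
        (\<lambda>y. (\<Sum>j\<in>UNIV. (complex_of_real (A y) *s g y) $ j * cnj (h y $ j)) -
          (\<Sum>j\<in>UNIV. (complex_of_real (A y) *s g' y) $ j * cnj (h y $ j)))"
      by (simp add: algebra_simps sum_subtractf)
    then show ?thesis
      unfolding B_def L2_inner_def torus_mean_def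
      using w(1)[OF that(1,3)] w(1)[OF that(2,3)]
      by (simp only: Bochner_Integration.integral_diff scaleR_right_diff_distrib)
  qed
  have diff_right: "B g (\<lambda>y. h y - h' y) = B g h - B g h'"
    if "g \<in> torus_L2" "h \<in> torus_L2" "h' \<in> torus_L2" for g h h'
  proof -
    have "(\<lambda>y. \<Sum>j\<in>UNIV. (complex_of_real (A y) *s g y) $ j * cnj ((h y - h' y) $ j)) =
        (\<lambda>y. (\<Sum>j\<in>UNIV. (complex_of_real (A y) *s g y) $ j * cnj (h y $ j)) -
          (\<Sum>j\<in>UNIV. (complex_of_real (A y) *s g y) $ j * cnj (h' y $ j)))"
      by (simp add: algebra_simps sum_subtractf)
    then show ?thesis
      unfolding B_def L2_inner_def torus_mean_def
      using w(1)[OF that(1,2)] w(1)[OF that(1,3)]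
      by (simp only: Bochner_Integration.integral_diff scaleR_right_diff_distrib)
  qed
  define x where "x i = torus_norm (\<lambda>y. g y - gs i y)" for i
  define z where "z i = torus_norm (\<lambda>y. h y - hs i y)" for i
  have bound: "norm (B (gs i) (hs i) - B g h) \<le>
      C * (x i * z i) + C * (x i * torus_norm h) + C * (torus_norm g * z i)" for i
  proof -
    \<comment> \<open>Expanded around the limits g and h, every term on the right contains a
      difference that tends to 0.\<close>
    have eq: "B (gs i) (hs i) - B g h = B (\<lambda>y. g y - gs i y) (\<lambda>y. h y - hs i y)
        - B (\<lambda>y. g y - gs i y) h - B g (\<lambda>y. h y - hs i y)"
      by (simp add: diff_left diff_right torus_L2_diff g h)
    have "norm (B (gs i) (hs i) - B g h) \<le> norm (B (\<lambda>y. g y - gs i y) (\<lambda>y. h y - hs i y))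
        + norm (B (\<lambda>y. g y - gs i y) h) + norm (B g (\<lambda>y. h y - hs i y))"
      unfolding eq by (intro order_trans[OF norm_triangle_ineq4] add_right_mono norm_triangle_ineq4)
    also have "\<dots> \<le> C * (x i * z i) + C * (x i * torus_norm h) + C * (torus_norm g * z i)"
      unfolding B_def x_def z_def by (intro add_mono w(2) torus_L2_diff g h)
    finally show ?thesis .
  qed
  have "((\<lambda>i. C * (x i * z i) + C * (x i * torus_norm h) + C * (torus_norm g * z i)) \<longlongrightarrow>
      C * (0 * 0) + C * (0 * torus_norm h) + C * (torus_norm g * 0)) \<F>"
  proof -
    have "(x \<longlongrightarrow> 0) \<F>" "(z \<longlongrightarrow> 0) \<F>"
      using g(3) h(3) by (simp_all add: x_def[abs_def] z_def[abs_def])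
    then show ?thesis
      by (intro tendsto_add tendsto_mult tendsto_const)
  qed
  then have "((\<lambda>i. C * (x i * z i) + C * (x i * torus_norm h) + C * (torus_norm g * z i)) \<longlongrightarrow> 0) \<F>"
    by simp
  then have "((\<lambda>i. B (gs i) (hs i) - B g h) \<longlongrightarrow> 0) \<F>"
    by (rule Lim_null_comparison[OF always_eventually, rotated]) (rule allI, rule bound)
  then show ?thesis unfolding B_def by (rule LIM_zero_cancel)
qed

text \<open>Both partial sums contain the modes in T, so their difference lives outside T with
  coefficients of modulus at most |c_k|; Parseval turns this into the tail.\<close>

lemma torus_mean_trig_diff_le:
  assumes c: "ell2 c" and "finite F" "finite G" "T \<subseteq> F" "T \<subseteq> G"
  shows "torus_mean (\<lambda>y. (norm (trig F c y - trig G c y))\<^sup>2) \<le>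
    (ell2_norm (\<lambda>k. c k - (if k \<in> T then c k else 0)))\<^sup>2"
proof -
  define c' where "c' k = (if k \<in> F then c k else 0) - (if k \<in> G then c k else 0)" for k
  define e where "e k = c k - (if k \<in> T then c k else 0)" for k
  have e: "ell2 e"
    unfolding e_def by (intro ell2_diff(1) ell2_truncate(1) c)
  have "trig F c y - trig G c y = trig (F \<union> G) c' y" for y
  proof -
    have "trig F c y = (\<Sum>k\<in>F \<union> G. torus_char k y *s (if k \<in> F then c k else 0))"
      unfolding trig_def using assms by (intro sum.mono_neutral_cong_left) auto
    moreover have "trig G c y = (\<Sum>k\<in>F \<union> G. torus_char k y *s (if k \<in> G then c k else 0))"
      unfolding trig_def using assms by (intro sum.mono_neutral_cong_left) auto
    ultimately show ?thesis
      by (simp add: trig_def c'_def vector_ssub_ldistrib sum_subtractf)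
  qed
  then have "torus_mean (\<lambda>y. (norm (trig F c y - trig G c y))\<^sup>2) = (\<Sum>k\<in>F \<union> G. (norm (c' k))\<^sup>2)"
    using assms by (simp add: torus_mean_trig_power2)
  also have "\<dots> \<le> (\<Sum>k\<in>F \<union> G. (norm (e k))\<^sup>2)"
    using assms by (intro sum_mono power_mono) (auto simp: c'_def e_def)
  also have "\<dots> \<le> (\<Sum>\<^sub>\<infinity>k. (norm (e k))\<^sup>2)"
    using e assms unfolding ell2_def by (intro finite_sum_le_infsum) auto
  finally show ?thesis by (simp add: ell2_norm_power2 e_def)
qed

text \<open>On the cell, which has finite measure, Cauchy-Schwarz turns L2 closeness of partial sums
  into L1 closeness, and an L1 Cauchy sequence has a subsequence converging almost everywhere. Its
  limit is g, and Fatou's lemma recovers the L2 distance from g to the partial sums.\<close>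

theorem Riesz_Fischer_torus:
  fixes c :: "int ^ 'n \<Rightarrow> complex ^ 'd"
  assumes c: "ell2 c"
  shows "\<exists>g. has_L2_fourier_series c g"
proof -
  let ?M = "lebesgue_on (torus_cell :: (real ^ 'n) set)"
  define tail where "tail S = ell2_norm (\<lambda>k. c k - (if k \<in> S then c k else 0))" for S
  define V where "V = ((2 * pi) ^ CARD('n) :: real)"
  have V: "0 < V" by (simp add: V_def)
  have mean: "torus_mean f = (LINT y|?M. f y) / V" for f :: "real ^ 'n \<Rightarrow> real"
    by (simp add: torus_mean_def V_def field_simps)
  have tail_mono: "tail T \<le> tail S" if "S \<subseteq> T" for S T
    unfolding tail_def using that by (intro ell2_mono(2) ell2_diff(1) ell2_truncate(1) c) auto
  have tail_nonneg: "0 \<le> tail S" for S by (simp add: tail_def)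
  have "\<exists>S. finite S \<and> tail S < inverse (real (Suc i))" for i
  proof -
    have "eventually (\<lambda>S. tail S < inverse (real (Suc i))) (finite_subsets_at_top UNIV)"
      using ell2_truncate_tendsto[OF c] unfolding tail_def
      by (rule order_tendstoD) simp
    then show ?thesis unfolding eventually_finite_subsets_at_top by blast
  qed
  then obtain S where S: "\<And>i. finite (S i)" "\<And>i. tail (S i) < inverse (real (Suc i))"
    by metis
  \<comment> \<open>Unions make the sets increase, so any two partial sums from index N on contain
    \<open>T N\<close> and differ by at most its tail.\<close>
  define T where "T i = (\<Union>j\<le>i. S j)" for i
  have T: "finite (T i)" "tail (T i) < inverse (real (Suc i))" for i
    using S tail_mono[of "S i" "T i"] by (auto simp: T_def intro: le_less_trans)
  have Tmono: "T i \<subseteq> T j" if "i \<le> j" for i j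
    unfolding T_def using that by (intro UN_mono) auto
  have tail1: "tail (T i) \<le> 1" for i
    using T(2)[of i] inverse_le_1_iff[of "real (Suc i)"] by linarith
  have diff: "(LINT y|?M. (norm (trig F c y - trig G c y))\<^sup>2) \<le> V * (tail R)\<^sup>2"
    if "finite F" "finite G" "R \<subseteq> F" "R \<subseteq> G" for F G R
    using torus_mean_trig_diff_le[OF c that] V by (simp add: mean tail_def field_simps)
  have sqint: "integrable ?M (\<lambda>y. (norm (trig F c y - trig G c y))\<^sup>2)" for F G
    using torus_L2_diff[OF trig_in_torus_L2 trig_in_torus_L2] by (simp add: torus_L2_def)
  have L1: "integrable ?M (trig F c)" for F
    by (rule integrable_torus_bounded[OF measurable_trig trig_bounded])
  have one: "integrable ?M (\<lambda>_. 1\<^sup>2 :: real)"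
    by (rule integrable_torus_bounded[where C = 1]) auto
  define K where "K = sqrt V * sqrt (LINT y|?M. 1\<^sup>2)"
  have cauchy: "\<exists>N. \<forall>i\<ge>N. \<forall>j\<ge>N. (LINT y|?M. norm (trig (T i) c y - trig (T j) c y)) < e"
    if e: "0 < e" for e
  proof -
    obtain N :: nat where N: "K / e < real N" using reals_Archimedean2 by blast
    have "(LINT y|?M. norm (trig (T i) c y - trig (T j) c y)) < e" if "N \<le> i" "N \<le> j" for i j
    proof -
      have "(LINT y|?M. norm (trig (T i) c y - trig (T j) c y) * 1) \<le>
          sqrt (LINT y|?M. (norm (trig (T i) c y - trig (T j) c y))\<^sup>2) * sqrt (LINT y|?M. 1\<^sup>2)"
        by (rule integral_Cauchy_Schwarz[OF _ _ sqint one]) measurable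
      also have "\<dots> \<le> sqrt (V * (tail (T N))\<^sup>2) * sqrt (LINT y|?M. 1\<^sup>2)"
        using that T Tmono by (intro mult_right_mono real_sqrt_le_mono diff) auto
      also have "\<dots> = tail (T N) * K"
        using tail_nonneg[of "T N"] by (simp add: K_def real_sqrt_mult)
      also have "\<dots> \<le> inverse (real (Suc N)) * K"
        using T(2)[of N] V by (intro mult_right_mono) (auto simp: K_def)
      also have "\<dots> < e"
      proof -
        have "K < e * real N" using N e by (simp add: field_simps)
        also have "\<dots> \<le> e * real (Suc N)" using e by simp
        finally show ?thesis by (simp add: field_simps)
      qed
      finally show ?thesis by simp
    qed
    then show ?thesis by blast
  qed
  obtain r where r: "strict_mono r" and AEC: "AE y in ?M. Cauchy (\<lambda>i. trig (T (r i)) c y)"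
    using cauchy_L1_AE_cauchy_subseq[OF L1 cauchy] by blast
  define g where "g y = lim (\<lambda>i. trig (T (r i)) c y)" for y
  have g [measurable]: "g \<in> borel_measurable ?M"
    unfolding g_def by (intro borel_measurable_lim_metric measurable_trig)
  have lim: "AE y in ?M. (\<lambda>i. trig (T (r i)) c y) \<longlonglongrightarrow> g y"
    using AEC unfolding g_def by eventually_elim (simp add: Cauchy_convergent convergent_LIMSEQ_iff[symmetric])
  \<comment> \<open>F is any finite superset of \<open>T i\<close>, not just some
    \<open>T j\<close>: this yields convergence along the net of all finite sets, as
    \<open>has_L2_fourier_series\<close> demands.\<close>
  have fatou: "(\<integral>\<^sup>+y. ennreal ((norm (g y - trig F c y))\<^sup>2) \<partial>?M) \<le> ennreal (V * (tail (T i))\<^sup>2)"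
    if F: "finite F" "T i \<subseteq> F" for F i
  proof -
    have "(\<integral>\<^sup>+y. ennreal ((norm (g y - trig F c y))\<^sup>2) \<partial>?M) =
        (\<integral>\<^sup>+y. liminf (\<lambda>j. ennreal ((norm (trig (T (r j)) c y - trig F c y))\<^sup>2)) \<partial>?M)"
    proof (rule nn_integral_cong_AE)
      show "AE y in ?M. ennreal ((norm (g y - trig F c y))\<^sup>2) =
          liminf (\<lambda>j. ennreal ((norm (trig (T (r j)) c y - trig F c y))\<^sup>2))"
        using lim
      proof eventually_elim
        case (elim y)
        then have "(\<lambda>j. ennreal ((norm (trig (T (r j)) c y - trig F c y))\<^sup>2)) \<longlonglongrightarrow>
            ennreal ((norm (g y - trig F c y))\<^sup>2)"
          by (intro tendsto_intros)
        then show ?case by (intro lim_imp_Liminf[symmetric]) auto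
      qed
    qed
    also have "\<dots> \<le> liminf (\<lambda>j. \<integral>\<^sup>+y. ennreal ((norm (trig (T (r j)) c y - trig F c y))\<^sup>2) \<partial>?M)"
      by (rule nn_integral_liminf) measurable
    also have "\<dots> \<le> ennreal (V * (tail (T i))\<^sup>2)"
    proof (rule Liminf_le)
      have "(\<integral>\<^sup>+y. ennreal ((norm (trig (T (r j)) c y - trig F c y))\<^sup>2) \<partial>?M) \<le> ennreal (V * (tail (T i))\<^sup>2)"
        if "i \<le> j" for j
      proof -
        have "T i \<subseteq> T (r j)"
          using that seq_suble[OF r, of j] by (intro Tmono) simp
        then show ?thesis
          using diff[OF T(1) F(1) _ F(2)] by (simp add: nn_integral_eq_integral sqint ennreal_leI)
      qed
      then show "eventually (\<lambda>j. (\<integral>\<^sup>+y. ennreal ((norm (trig (T (r j)) c y - trig F c y))\<^sup>2) \<partial>?M)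
          \<le> ennreal (V * (tail (T i))\<^sup>2)) sequentially"
        using eventually_ge_at_top[of i] by (rule eventually_mono[rotated])
    qed simp
    finally show ?thesis .
  qed
  have gint: "integrable ?M (\<lambda>y. (norm (g y - trig F c y))\<^sup>2)" if F: "finite F" "T i \<subseteq> F" for F i
  proof (rule integrableI_bounded)
    show "(\<integral>\<^sup>+y. ennreal (norm ((norm (g y - trig F c y))\<^sup>2)) \<partial>?M) < \<infinity>"
      using fatou[OF F] by (auto simp: less_top[symmetric] top_unique)
  qed measurable
  have gmean: "torus_mean (\<lambda>y. (norm (g y - trig F c y))\<^sup>2) \<le> (tail (T i))\<^sup>2"
    if F: "finite F" "T i \<subseteq> F" for F i
  proof -
    have "(LINT y|?M. (norm (g y - trig F c y))\<^sup>2) \<le> V * (tail (T i))\<^sup>2"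
      using fatou[OF F] V by (simp add: nn_integral_eq_integral gint[OF F] ennreal_le_iff)
    then show ?thesis using V by (simp add: mean field_simps)
  qed
  have "(\<lambda>y. g y - trig (T 0) c y) \<in> torus_L2"
    using gint[OF T(1) order_refl] unfolding torus_L2_def by simp
  \<comment> \<open>Adding the partial sum back is phrased as subtracting the one with coefficients
    -c.\<close>
  from torus_L2_diff[OF this trig_in_torus_L2[of "T 0" "\<lambda>k. - c k"]]
  have gL2: "g \<in> torus_L2"
    by (simp add: trig_def sum_negf vector_sneg_minus1[symmetric])
  have "((\<lambda>F. torus_mean (\<lambda>y. (norm (g y - trig F c y))\<^sup>2)) \<longlongrightarrow> 0) (finite_subsets_at_top UNIV)"
  proof (rule tendstoI)
    fix e :: real
    assume "0 < e"
    then obtain i where i: "inverse (real (Suc i)) < e" using reals_Archimedean by blast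
    have "dist (torus_mean (\<lambda>y. (norm (g y - trig F c y))\<^sup>2)) 0 < e" if "finite F" "T i \<subseteq> F" for F
    proof -
      have "torus_mean (\<lambda>y. (norm (g y - trig F c y))\<^sup>2) \<le> (tail (T i))\<^sup>2"
        by (rule gmean[OF that])
      also have "\<dots> \<le> tail (T i)"
        using tail1[of i] tail_nonneg[of "T i"] by (simp add: power2_eq_square mult_left_le)
      also have "\<dots> < e" using T(2)[of i] i by simp
      finally show ?thesis
        using torus_mean_nonneg[of "\<lambda>y. (norm (g y - trig F c y))\<^sup>2"] by simp
    qed
    then show "eventually (\<lambda>F. dist (torus_mean (\<lambda>y. (norm (g y - trig F c y))\<^sup>2)) 0 < e)
        (finite_subsets_at_top UNIV)"
      unfolding eventually_finite_subsets_at_top using T(1)[of i] by blast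
  qed
  then show ?thesis
    using gL2 unfolding has_L2_fourier_series_def trig_def by blast
qed


section \<open>The variational problem\<close>

lemma HP_weight_eq_power2:
  "norm (P *v real_vec k) powr (2 * s) * (norm (U k))\<^sup>2 =
    (norm (norm (P *v real_vec k) powr s * norm (U k)))\<^sup>2"
proof -
  have "x powr (2 * s) = (x powr s)\<^sup>2" for x :: real
    by (simp add: power2_eq_square flip: powr_add)
  then show ?thesis by (simp add: power_mult_distrib)
qed

text \<open>The index 0, left out of the defining sum, contributes zero because U 0 = 0, so the sum
  may run over all frequencies.\<close>

lemma HP_space_iff_ell2:
  "U \<in> HP_space P s \<longleftrightarrow> U 0 = 0 \<and> ell2 (\<lambda>k. norm (P *v real_vec k) powr s * norm (U k))"
  unfolding HP_space_def ell2_def HP_weight_eq_power2 mem_Collect_eq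
  by (intro conj_cong refl summable_on_cong_neutral) auto

lemma HP_norm_eq_ell2_norm:
  "U 0 = 0 \<Longrightarrow> HP_norm P s U = ell2_norm (\<lambda>k. norm (P *v real_vec k) powr s * norm (U k))"
  unfolding HP_norm_def ell2_norm_def HP_weight_eq_power2
  by (intro arg_cong[where f = sqrt] infsum_cong_neutral) auto

text \<open>Riesz-Fischer gives the choice in \<open>P_grad\<close> a witness; afterwards only this
  property of the chosen function is used.\<close>

lemma P_grad_fourier_series:
  assumes "ell2 (\<lambda>k. \<chi> j. \<i> * complex_of_real ((P *v real_vec k) $ j) * U k)"
  shows "has_L2_fourier_series (\<lambda>k. \<chi> j. \<i> * complex_of_real ((P *v real_vec k) $ j) * U k) (P_grad P U)"
  unfolding P_grad_def by (rule someI_ex[OF Riesz_Fischer_torus[OF assms]])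

lemma norm_vec_of_real_mult:
  "norm (\<chi> j. complex_of_real (x $ j) * z :: complex ^ 'd) = norm x * norm z"
  by (simp add: norm_vec_def norm_mult L2_set_left_distrib)

theorem theorem3p1:
  fixes P :: "real ^ 'n ^ 'd"
    and A :: "real ^ 'n \<Rightarrow> real"
    and \<alpha>0 \<alpha>1 C_A N :: real
    and m :: nat
    and F :: "int ^ 'n \<Rightarrow> complex"
  assumes "rat_independent_columns P"
    and "torus_periodic A"
    and "A \<in> borel_measurable lebesgue"
    and "0 < \<alpha>0"
    and "\<forall>y. \<alpha>0 \<le> A y \<and> A y \<le> \<alpha>1"
    and "0 < C_A"
    and "\<forall>k. norm (fourier_coeff (\<lambda>y. complex_of_real (A y)) k)
               \<le> C_A * (1 + norm (real_vec k)) powr (- N)"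
    and "N > real CARD('n) + real m + 1"
    and "F \<in> HP_space P (- 1) \<inter> HP_space P (real m)"
  shows "(\<exists>!U. U \<in> HP_space P 1 \<and> (\<forall>V \<in> HP_space P 1. a_form A P U V = HP_pairing F V)) \<and>
         (\<forall>U. U \<in> HP_space P 1 \<and> (\<forall>V \<in> HP_space P 1. a_form A P U V = HP_pairing F V) \<longrightarrow>
            U \<in> HP_space P (real m + 2) \<and>
            HP_norm P (real m + 2) U
              \<le> C_const \<alpha>0 CARD('d) (C_lambda_A P C_A N) m
                  * (HP_norm P (- 1) F + HP_norm P (real m) F))"
proof -
  define p where "p k = P *v real_vec k" for k
  define r where "r k = norm (p k)" for k
  define coeff where "coeff = fourier_coeff (\<lambda>y. complex_of_real (A y))"
  define a where "a k = norm (coeff k)" for k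
  \<comment> \<open>\<open>sgn\<close> of a vector is its direction, with value 0 at the zero
    vector; so row and column 0 of \<open>h\<close> vanish.\<close>
  define h where "h k l = coeff (k - l) * complex_of_real (sgn (p k) \<bullet> sgn (p l))" for k l
  define B where "B = C_lambda_A P C_A N"
  have p0: "p 0 = 0" by (simp add: p_def)
  have pnz: "p k \<noteq> 0" if "k \<noteq> 0" for k
    unfolding p_def by (rule rat_independent_columns_nonzero[OF assms(1) that])
  have r0: "r 0 = 0" and r_nonneg: "0 \<le> r k" and rpos: "k \<noteq> 0 \<Longrightarrow> 0 < r k" for k
    using pnz[of k] by (simp_all add: r_def p0)
  have r_diff: "\<bar>r k - r l\<bar> \<le> r (k - l)" for k l
    unfolding r_def p_def real_vec_diff matrix_vector_mult_diff_distrib by (rule norm_triangle_ineq3)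
  have A_meas: "A \<in> borel_measurable (lebesgue_on torus_cell)"
    by (rule measurable_restrict_space1[OF assms(3)])
  have A_bdd: "\<alpha>0 \<le> A y" "A y \<le> \<alpha>1" "\<bar>A y\<bar> \<le> \<alpha>1" for y
    using assms(4,5) by (auto simp: abs_if) (smt (verit))
  have a_sum: "(\<lambda>k. a k * r k ^ b) summable_on UNIV" "(\<Sum>\<^sub>\<infinity>k. a k * r k ^ b) \<le> B b" if "b \<le> m + 1" for b
    unfolding r_def p_def B_def using weighted_coeff_sum_le_C_lambda_A[of a C_A N b P] assms(6-8) that
    by (simp_all add: a_def coeff_def)
  have B_nonneg: "0 \<le> B b" for b
    unfolding B_def using assms(6) by (simp add: C_lambda_A_nonneg)
  interpret coercive_matrix a h \<alpha>0
  proof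
    show "a summable_on UNIV" using a_sum(1)[of 0] by simp
    show "norm (h k l) \<le> a (k - l)" for k l
    proof -
      have "\<bar>sgn (p k) \<bullet> sgn (p l)\<bar> \<le> 1"
        using Cauchy_Schwarz_ineq2[of "sgn (p k)" "sgn (p l)"] by (simp add: norm_sgn split: if_splits)
      then show ?thesis
        unfolding h_def norm_mult a_def by (intro mult_left_le) auto
    qed
    show "\<alpha>0 * (\<Sum>k\<in>S. (norm (u k))\<^sup>2) \<le> Re (\<Sum>k\<in>S. \<Sum>l\<in>S. h k l * u l * cnj (u k))"
      if "finite S" "0 \<notin> S" for S and u :: "int ^ 'n \<Rightarrow> complex"
    proof -
      \<comment> \<open>The vector coefficients u_k e_k have modulus |u_k| for k \<noteq> 0, and
        their products supply the factor e_k . e_l of \<open>h\<close>; coercivity for trigonometric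
        polynomials thereby becomes coercivity of \<open>h\<close>.\<close>
      define c :: "int ^ 'n \<Rightarrow> complex ^ 'd" where "c k = (\<chi> j. complex_of_real (sgn (p k) $ j) * u k)" for k
      have "(\<Sum>k\<in>S. (norm (c k))\<^sup>2) = (\<Sum>k\<in>S. (norm (u k))\<^sup>2)"
      proof (rule sum.cong[OF refl])
        fix k assume "k \<in> S"
        then have "k \<noteq> 0" using that by auto
        then show "(norm (c k))\<^sup>2 = (norm (u k))\<^sup>2"
          by (simp add: c_def norm_vec_of_real_mult norm_sgn pnz)
      qed
      moreover have "coeff (k - l) * (\<Sum>j\<in>UNIV. c l $ j * cnj (c k $ j)) = h k l * u l * cnj (u k)" for k l
        by (simp add: c_def h_def inner_vec_def sum_distrib_left sum_distrib_right mult_ac)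
      ultimately show ?thesis
        using coercive_trig[OF A_meas A_bdd(1,2) that(1), of c] by (simp add: coeff_def)
    qed
  qed (auto simp: a_def h_def p0 assms(4))

  \<comment> \<open>The variational form as the form of the matrix \<open>h\<close>\<close>
  define w where "w U = (\<lambda>k. complex_of_real (r k) * U k)" for U :: "int ^ 'n \<Rightarrow> complex"
  have HP1: "U \<in> HP_space P 1 \<longleftrightarrow> U 0 = 0 \<and> ell2 (w U)" for U
    unfolding HP_space_iff_ell2
    by (intro conj_cong refl ell2_cong) (simp add: w_def r_def p_def norm_mult)
  have w0: "w U 0 = 0" for U by (simp add: w_def r0)
  have a_form: "a_form A P U V = ell2_inner (app (w U)) (w V)"
    if "U \<in> HP_space P 1" "V \<in> HP_space P 1" for U V
  proof -
    define c :: "(int ^ 'n \<Rightarrow> complex) \<Rightarrow> int ^ 'n \<Rightarrow> complex ^ 'd"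
      where "c U = (\<lambda>k. \<chi> j. \<i> * complex_of_real ((P *v real_vec k) $ j) * U k)" for U
    have cn: "norm (c U k) = norm (w U k)" for U k
      using norm_vec_of_real_mult[of "p k" "\<i> * U k"]
      by (simp add: c_def w_def r_def p_def norm_mult mult_ac)
    have series: "P_grad P U \<in> torus_L2"
      "((\<lambda>S. torus_norm (\<lambda>y. P_grad P U y - trig S (c U) y)) \<longlongrightarrow> 0) (finite_subsets_at_top UNIV)"
      if "U \<in> HP_space P 1" for U
    proof -
      have "ell2 (c U)" using that HP1 ell2_cong[of "c U" "w U"] cn by blast
      then have "has_L2_fourier_series (c U) (P_grad P U)"
        unfolding c_def by (rule P_grad_fourier_series)
      then have *: "P_grad P U \<in> torus_L2"
        "((\<lambda>S. torus_mean (\<lambda>y. (norm (P_grad P U y - trig S (c U) y))\<^sup>2)) \<longlongrightarrow> 0) (finite_subsets_at_top UNIV)"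
        unfolding has_L2_fourier_series_def trig_def by auto
      show "P_grad P U \<in> torus_L2" by (rule *)
      show "((\<lambda>S. torus_norm (\<lambda>y. P_grad P U y - trig S (c U) y)) \<longlongrightarrow> 0) (finite_subsets_at_top UNIV)"
        unfolding torus_norm_def using tendsto_real_sqrt[OF *(2)] by simp
    qed
    have "((\<lambda>S. L2_inner (\<lambda>y. complex_of_real (A y) *s trig S (c U) y) (trig S (c V))) \<longlongrightarrow> a_form A P U V)
        (finite_subsets_at_top UNIV)"
      unfolding a_form_def
      by (rule L2_inner_tendsto[OF A_meas A_bdd(3)]) (intro series that trig_in_torus_L2)+
    moreover have "eventually (\<lambda>S. L2_inner (\<lambda>y. complex_of_real (A y) *s trig S (c U) y) (trig S (c V)) =
        (\<Sum>k\<in>S. \<Sum>l\<in>S. h k l * w U l * cnj (w V k))) (finite_subsets_at_top UNIV)"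
    proof (rule eventually_finite_subsets_at_top_weakI)
      fix S :: "(int ^ 'n) set"
      assume S: "finite S"
      have "L2_inner (\<lambda>y. complex_of_real (A y) *s trig S (c U) y) (trig S (c V)) =
          torus_mean (\<lambda>y. \<Sum>j\<in>UNIV. complex_of_real (A y) * trig S (c U) y $ j * cnj (trig S (c V) y $ j))"
        unfolding L2_inner_def by simp
      also have "\<dots> = (\<Sum>k\<in>S. \<Sum>l\<in>S. coeff (k - l) * (\<Sum>j\<in>UNIV. c U l $ j * cnj (c V k $ j)))"
        unfolding coeff_def by (rule torus_mean_form[where C = \<alpha>1]) (use A_meas A_bdd(3) S in auto)
      also have "\<dots> = (\<Sum>k\<in>S. \<Sum>l\<in>S. h k l * w U l * cnj (w V k))"
      proof (intro sum.cong refl)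
        fix k l
        \<comment> \<open>The lengths |p_k| and |p_l| go into \<open>w V\<close> and
          \<open>w U\<close>, leaving the directions in \<open>h\<close>; the factor \<i> of one
          gradient cancels against its conjugate from the other.\<close>
        have "sgn (p k) \<bullet> sgn (p l) * (r k * r l) = p k \<bullet> p l"
          by (cases "p k = 0 \<or> p l = 0") (auto simp: sgn_div_norm r_def field_simps)
        then have "complex_of_real (p k \<bullet> p l) =
            complex_of_real (sgn (p k) \<bullet> sgn (p l)) * (complex_of_real (r k) * complex_of_real (r l))"
          by (metis of_real_mult)
        moreover have "(\<Sum>j\<in>UNIV. c U l $ j * cnj (c V k $ j)) = complex_of_real (p k \<bullet> p l) * (U l * cnj (V k))"
          by (simp add: c_def p_def inner_vec_def sum_distrib_left sum_distrib_right mult_ac)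
        ultimately show "coeff (k - l) * (\<Sum>j\<in>UNIV. c U l $ j * cnj (c V k $ j)) = h k l * w U l * cnj (w V k)"
          by (simp add: h_def w_def mult_ac)
      qed
      finally show "L2_inner (\<lambda>y. complex_of_real (A y) *s trig S (c U) y) (trig S (c V)) =
          (\<Sum>k\<in>S. \<Sum>l\<in>S. h k l * w U l * cnj (w V k))" .
    qed
    ultimately have "((\<lambda>S. \<Sum>k\<in>S. \<Sum>l\<in>S. h k l * w U l * cnj (w V k)) \<longlongrightarrow> a_form A P U V)
        (finite_subsets_at_top UNIV)"
      by (simp add: tendsto_cong)
    moreover have "((\<lambda>S. \<Sum>k\<in>S. \<Sum>l\<in>S. h k l * w U l * cnj (w V k)) \<longlongrightarrow> ell2_inner (app (w U)) (w V))
        (finite_subsets_at_top UNIV)"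
      using that HP1 by (intro form_tendsto) auto
    ultimately show ?thesis
      by (rule tendsto_unique[rotated]) simp
  qed

  \<comment> \<open>The variational problem as the linear system T u = f\<close>
  define f where "f k = F k / complex_of_real (r k)" for k
  have F0: "F 0 = 0" using assms(9) by (simp add: HP_space_def)
  have f0: "f 0 = 0" by (simp add: f_def F0)
  \<comment> \<open>Division by |p_k| shifts the weight by one: order -1 of F is r^0 on f, and order
    m is r^(m + 1) on f.\<close>
  have F_low: "norm (norm (P *v real_vec k) powr (- 1) * norm (F k)) = norm (r k ^ 0 * norm (f k))" for k
    by (cases "k = 0") (use rpos[of k] in \<open>auto simp: F0 f0 f_def r_def p_def powr_minus norm_divide field_simps\<close>)
  have F_high: "norm (norm (P *v real_vec k) powr real m * norm (F k)) = norm (r k ^ (m + 1) * norm (f k))" for k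
    by (cases "k = 0")
      (use rpos[of k] in \<open>auto simp: F0 f0 f_def r_def p_def powr_realpow norm_divide abs_mult power_abs\<close>)
  have f_ell2: "ell2 (\<lambda>k. r k ^ 0 * norm (f k))" "ell2 (\<lambda>k. r k ^ (m + 1) * norm (f k))"
    using assms(9) ell2_cong[of "\<lambda>k. norm (P *v real_vec k) powr (- 1) * norm (F k)", OF F_low]
      ell2_cong[of "\<lambda>k. norm (P *v real_vec k) powr real m * norm (F k)", OF F_high]
    unfolding Int_iff HP_space_iff_ell2 by blast+
  have F_norm: "HP_norm P (- 1) F = ell2_norm (\<lambda>k. r k ^ 0 * norm (f k))"
    "HP_norm P (real m) F = ell2_norm (\<lambda>k. r k ^ (m + 1) * norm (f k))"
    unfolding HP_norm_eq_ell2_norm[of F, OF F0]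
    by (rule ell2_norm_cong[OF F_low], rule ell2_norm_cong[OF F_high])
  have f2: "ell2 f" using f_ell2(1) ell2_cong[of f "\<lambda>k. r k ^ 0 * norm (f k)"] by simp
  have equiv: "(\<forall>V \<in> HP_space P 1. a_form A P U V = HP_pairing F V) \<longleftrightarrow> (\<forall>k. app (w U) k = f k)"
    if U: "U \<in> HP_space P 1" for U
  proof
    assume *: "\<forall>V \<in> HP_space P 1. a_form A P U V = HP_pairing F V"
    show "\<forall>k. app (w U) k = f k"
    proof
      fix k
      show "app (w U) k = f k"
      proof (cases "k = 0")
        case True
        then show ?thesis by (simp add: app_at_zero f0)
      next
        case False
        \<comment> \<open>Testing with the single mode k isolates one equation, multiplied by r k >
          0.\<close>
        define V where "V = (\<lambda>l. if l = k then 1 else 0 :: complex)"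
        have V: "V \<in> HP_space P 1"
          unfolding HP1 using False
          by (auto simp: V_def w_def intro!: ell2_finite_support[of "{k}"] split: if_splits)
        have "ell2_inner (app (w U)) (w V) = (\<Sum>\<^sub>\<infinity>l\<in>{k}. app (w U) l * cnj (w V l))"
          unfolding ell2_inner_def by (rule infsum_cong_neutral) (auto simp: V_def w_def)
        then have 1: "ell2_inner (app (w U)) (w V) = app (w U) k * complex_of_real (r k)"
          by (simp add: V_def w_def)
        have "HP_pairing F V = (\<Sum>\<^sub>\<infinity>l\<in>{k}. F l * cnj (V l))"
          unfolding HP_pairing_def by (rule infsum_cong_neutral) (use False in \<open>auto simp: V_def\<close>)
        then have 2: "HP_pairing F V = F k" by (simp add: V_def)
        have "app (w U) k * complex_of_real (r k) = F k"
          using * V a_form[OF U V] 1 2 by simp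
        then show ?thesis using rpos[OF False] by (simp add: f_def field_simps)
      qed
    qed
  next
    assume *: "\<forall>k. app (w U) k = f k"
    show "\<forall>V \<in> HP_space P 1. a_form A P U V = HP_pairing F V"
    proof
      fix V
      assume V: "V \<in> HP_space P 1"
      have "ell2_inner (app (w U)) (w V) = (\<Sum>\<^sub>\<infinity>k. f k * cnj (w V k))"
        using * by (simp add: ell2_inner_def)
      also have "\<dots> = HP_pairing F V"
        unfolding HP_pairing_def
        by (rule infsum_cong_neutral) (auto simp: F0 f_def w_def dest: rpos)
      finally show "a_form A P U V = HP_pairing F V" using a_form[OF U V] by simp
    qed
  qed

  \<comment> \<open>Existence and uniqueness\<close>
  have exists: "\<exists>U. U \<in> HP_space P 1 \<and> (\<forall>V \<in> HP_space P 1. a_form A P U V = HP_pairing F V)"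
  proof -
    obtain u where u: "ell2 u" "u 0 = 0" "\<And>k. app u k = f k"
      using app_surj[OF f2 f0] by blast
    \<comment> \<open>The inverse of \<open>w\<close>; at k = 0 the quotient 0 / 0 has the value 0,
      as membership in the space requires.\<close>
    define U where "U k = u k / complex_of_real (r k)" for k
    have wU: "w U = u"
    proof
      show "w U k = u k" for k
        by (cases "k = 0") (auto simp: w_def U_def u(2) dest: rpos)
    qed
    have "U \<in> HP_space P 1" unfolding HP1 wU using u by (simp add: U_def)
    then show ?thesis using equiv wU u(3) by auto
  qed
  have unique: "U = U'"
    if U: "U \<in> HP_space P 1" "\<forall>k. app (w U) k = f k" and U': "U' \<in> HP_space P 1" "\<forall>k. app (w U') k = f k"
    for U U'
  proof
    fix k
    have e: "ell2 (w U)" "ell2 (w U')" "U 0 = 0" "U' 0 = 0" using U U' HP1 by auto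
    have "w U k - w U' k = 0"
      by (rule app_eq_0_imp[of "\<lambda>k. w U k - w U' k"])
        (use e U(2) U'(2) in \<open>auto simp: ell2_diff app_diff w0\<close>)
    then show "U k = U' k"
      using e(3,4) by (cases "k = 0") (auto simp: w_def dest: rpos)
  qed

  \<comment> \<open>Regularity and the norm estimate\<close>
  have regular: "U \<in> HP_space P (real m + 2) \<and>
      HP_norm P (real m + 2) U \<le> C_const \<alpha>0 CARD('d) B m * (HP_norm P (- 1) F + HP_norm P (real m) F)"
    if U: "U \<in> HP_space P 1" "\<forall>k. app (w U) k = f k" for U
  proof -
    define u where "u = w U"
    have u: "ell2 u" "u 0 = 0" "U 0 = 0" using U(1) HP1 w0 by (auto simp: u_def)
    have app_u: "app u k = f k" for k using U(2) by (simp add: u_def)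
    define E where "E s = ell2_norm (\<lambda>k. r k ^ s * norm (u k))" for s
    define \<Phi> where "\<Phi> s = ell2_norm (\<lambda>k. r k ^ s * norm (f k))" for s
    \<comment> \<open>The crude weights a = b = 1 are enough for membership; the finer ones enter
      the norm estimate.\<close>
    have f_s: "ell2 (\<lambda>k. r k ^ s * norm (f k))" if "s \<le> m + 1" for s
      by (rule ell2_interpolate(1)[OF r_nonneg _ _ _ f_ell2, of 1 1 s])
        (use power_le_1_plus_power[OF _ that] in simp_all)
    \<comment> \<open>At s = 0 the sum is empty and this is the energy bound of u by f with factor 1
      / \<alpha>0; level s then draws on all lower levels.\<close>
    have reg: "ell2 (\<lambda>k. r k ^ s * norm (u k)) \<and>
        E s \<le> inverse \<alpha>0 * (\<Phi> s + (\<Sum>j<s. real (s choose j) * B (s - j) * E j))" if "s \<le> m + 1" for s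
      using that
    proof (induction s rule: less_induct)
      case (less s)
      have B: "\<And>j. j < s \<Longrightarrow> (\<lambda>q. a q * r q ^ (s - j)) summable_on UNIV"
        "\<And>j. j < s \<Longrightarrow> (\<Sum>\<^sub>\<infinity>q. a q * r q ^ (s - j)) \<le> B (s - j)"
        using less.prems by (auto intro!: a_sum)
      have lower: "\<And>j. j < s \<Longrightarrow> ell2 (\<lambda>k. r k ^ j * norm (u k))"
        using less by auto
      have rhs: "ell2 (\<lambda>k. r k ^ s * norm (app u k))"
        unfolding app_u by (rule f_s[OF less.prems])
      from regularity[OF u(1,2) r_nonneg r_diff B lower rhs]
      show ?case unfolding E_def \<Phi>_def app_u by auto
    qed
    have "E (m + 1) \<le> C_const \<alpha>0 CARD('d) B m * (\<Phi> 0 + \<Phi> (m + 1))"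
    proof (rule a_priori_constant)
      show "0 \<le> \<Phi> s" for s by (simp add: \<Phi>_def)
      show "E s \<le> inverse \<alpha>0 * (\<Phi> s + (\<Sum>j<s. real (s choose j) * B (s - j) * E j))" if "s \<le> m + 1" for s
        using reg[OF that] by blast
      show "\<Phi> j \<le> x * \<Phi> 0 + y * \<Phi> s"
        if "s \<le> m + 1" "0 \<le> x" "0 \<le> y" "\<And>r. 0 \<le> r \<Longrightarrow> r ^ j \<le> x + y * r ^ s" for s j x y
        unfolding \<Phi>_def
        by (rule ell2_interpolate(2)[OF r_nonneg that(2,3,4) f_ell2(1) f_s[OF that(1)]])
    qed (use assms(4) B_nonneg in \<open>auto simp: Suc_le_eq\<close>)
    \<comment> \<open>u already carries one factor r, so order m + 2 of U is the weight r^(m + 1) on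
      u.\<close>
    moreover have U_high: "norm (norm (P *v real_vec k) powr (real m + 2) * norm (U k)) =
        norm (r k ^ (m + 1) * norm (u k))" for k
    proof (cases "k = 0")
      case False
      then have "r k powr (real m + 2) = r k ^ (m + 2)"
        using rpos[OF False] powr_realpow[of "r k" "m + 2"] by (simp add: add.commute)
      then show ?thesis
        by (simp add: u_def w_def r_def p_def norm_mult abs_mult power_abs mult_ac)
    qed (simp add: u)
    moreover have "HP_norm P (real m + 2) U = E (m + 1)"
      unfolding HP_norm_eq_ell2_norm[of U, OF u(3)] E_def by (rule ell2_norm_cong[OF U_high])
    moreover have "U \<in> HP_space P (real m + 2)"
      unfolding HP_space_iff_ell2 using u(3) reg[of "m + 1"]
        ell2_cong[of "\<lambda>k. norm (P *v real_vec k) powr (real m + 2) * norm (U k)", OF U_high] by blast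
    ultimately show ?thesis by (simp add: F_norm \<Phi>_def)
  qed
  define sol where "sol U \<longleftrightarrow> U \<in> HP_space P 1 \<and> (\<forall>V \<in> HP_space P 1. a_form A P U V = HP_pairing F V)"
    for U
  have solD: "U \<in> HP_space P 1" "\<forall>k. app (w U) k = f k" if "sol U" for U
    using that equiv[of U] unfolding sol_def by auto
  obtain U\<^sub>0 where U0: "sol U\<^sub>0" using exists unfolding sol_def by (elim exE)
  have "\<exists>!U. sol U"
    by (rule ex1I[of _ U\<^sub>0]) (rule U0, rule unique[OF solD solD[OF U0]])
  moreover have "\<forall>U. sol U \<longrightarrow> U \<in> HP_space P (real m + 2) \<and>
      HP_norm P (real m + 2) U \<le> C_const \<alpha>0 CARD('d) B m * (HP_norm P (- 1) F + HP_norm P (real m) F)"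
    by (intro allI impI regular solD)
  ultimately show ?thesis unfolding sol_def B_def by (rule conjI)
qed

end
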